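(* (1) $\mathrm{LF}_\Delta$ is strongly normalizing: (a) if $\Gamma\vdash_\Sigma K$ then $K$ is strongly normalizing; (b) if $\Gamma\vdash_\Sigma\sigma:K$ then $\sigma$ is strongly normalizing; (c) if $\Gamma\vdash_\Sigma\Delta:\sigma$ then $\Delta$ is strongly normalizing (all with respect to $\to_\Delta$). (2) Every strongly normalizing pure $\lambda$-term $M$ can be annotated so as to be the essence of a (typable) $\Delta$-term, i.e. there are $\Sigma,\Gamma,\Delta,\sigma$ with $\Gamma\vdash_\Sigma\Delta:\sigma$ and $|\Delta|=M$.
   Context: $\mathrm{LF}_\Delta$ pseudo-terms (up to $\alpha$-conversion; $a$ family constants, $c$ object constants, $x,y$ variables): Kinds $K ::= \mathrm{Type} \mid \Pi x{:}\sigma.K$; Families $\sigma,\tau ::= a \mid \Pi x{:}\sigma.\tau \mid \sigma\,\Delta \mid \sigma\to^{r}\tau \mid \sigma\cap\tau \mid \sigma\cup\tau$; Objects $\Delta ::= c \mid x \mid \lambda x{:}\sigma.\Delta \mid \Delta\,\Delta \mid \lambda^{r}x{:}\sigma.\Delta \mid \Delta @^{r}\Delta \mid \langle\Delta,\Delta\rangle \mid [\Delta,\Delta] \mid pr_l\,\Delta \mid pr_r\,\Delta \mid in_l^{\sigma}\,\Delta \mid in_r^{\sigma}\,\Delta$. Essence $|\Delta|$ (pure $\lambda$-term): $|c|=c$, $|x|=x$, $|\lambda x{:}\sigma.\Delta|=|\lambda^r x{:}\sigma.\Delta|=\lambda x.|\Delta|$, $|\Delta_1\Delta_2|=|\Delta_1||\Delta_2|$,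 $|\Delta_1@^r\Delta_2|=|\Delta_2|$, $|\langle\Delta_1,\Delta_2\rangle|=|[\Delta_1,\Delta_2]|=|\Delta_1|$, $|pr_i\Delta|=|in_i^\sigma\Delta|=|\Delta|$. Pairs/co-pairs are only considered when their components have identical essences. Reduction $\to_\Delta$: basic rules $(\lambda x{:}\sigma.\Delta_1)\Delta_2\to\Delta_1[\Delta_2/x]$, $pr_l\langle\Delta_1,\Delta_2\rangle\to\Delta_1$, $pr_r\langle\Delta_1,\Delta_2\rangle\to\Delta_2$, $[\Delta_1,\Delta_2](in_l^\sigma\Delta_3)\to\Delta_1\Delta_3$, $[\Delta_1,\Delta_2](in_r^\sigma\Delta_3)\to\Delta_2\Delta_3$, $(\lambda^r x{:}\sigma.\Delta_1)@^r\Delta_2\to\Delta_1[\Delta_2/x]$, closed under all constructors, except that components of pairs/co-pairs are reduced simultaneously ($\langle\Delta_1,\Delta_2\rangle\to\langle\Delta_1',\Delta_2'\rangle$ and $[\Delta_1,\Delta_2]\to[\Delta_1',\Delta_2']$ when $\Delta_i\to\Delta_i'$ for $i=1,2$ and $|\Delta_1'|\equiv|\Delta_2'|$). $=_\Delta$ is the reflexive, symmetric, transitive closure of $\to_\Delta$. $=_\eta$ denotes $\eta$-equality of pure $\lambda$-terms. Judgements: $\vdash\Sigma$, $\vdash_\Sigma\Gamma$, $\Gamma\vdash_\Sigma K$, $\Gamma\vdash_\Sigma\sigma:K$, $\Gamma\vdash_\Sigma\Delta:\sigma$, with rules: Signatures: $\vdash\emptyset$; $\vdash\Sigma,a{:}K$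 if $\vdash\Sigma$, $\vdash_\Sigma K$, $a\notin\mathrm{dom}\,\Sigma$; $\vdash\Sigma,c{:}\sigma$ if $\vdash\Sigma$, $\vdash_\Sigma\sigma:\mathrm{Type}$, $c\notin\mathrm{dom}\,\Sigma$. Contexts: $\vdash_\Sigma\langle\rangle$ if $\vdash\Sigma$; $\vdash_\Sigma\Gamma,x{:}\sigma$ if $\vdash_\Sigma\Gamma$, $\Gamma\vdash_\Sigma\sigma:\mathrm{Type}$, $x\notin\mathrm{dom}\,\Gamma$. Kinds: $\Gamma\vdash_\Sigma\mathrm{Type}$ if $\vdash_\Sigma\Gamma$; $\Gamma\vdash_\Sigma\Pi x{:}\sigma.K$ if $\Gamma,x{:}\sigma\vdash_\Sigma K$. Families: $\Gamma\vdash_\Sigma a:K$ if $\vdash_\Sigma\Gamma$, $a{:}K\in\Sigma$; $\Gamma\vdash_\Sigma\Pi x{:}\sigma.\tau:\mathrm{Type}$ if $\Gamma,x{:}\sigma\vdash_\Sigma\tau:\mathrm{Type}$; $\Gamma\vdash_\Sigma\sigma\,\Delta:K[\Delta/x]$ if $\Gamma\vdash_\Sigma\sigma:\Pi x{:}\tau.K$, $\Gamma\vdash_\Sigma\Delta:\tau$; $\sigma\to^r\tau$, $\sigma\cap\tau$, $\sigma\cup\tau$ have kind $\mathrm{Type}$ if $\sigma,\tau$ do; $\Gamma\vdash_\Sigma\sigma:K_2$ if $\Gamma\vdash_\Sigma\sigma:K_1$, $\Gamma\vdash_\Sigma K_2$, $K_1=_\Delta K_2$. Objects: constants and variables get their declared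 type (in a valid context); $\lambda x{:}\sigma.\Delta:\Pi x{:}\sigma.\tau$ if $\Gamma,x{:}\sigma\vdash_\Sigma\Delta:\tau$; $\Delta_1\Delta_2:\tau[\Delta_2/x]$ if $\Delta_1:\Pi x{:}\sigma.\tau$, $\Delta_2:\sigma$; $\lambda^r x{:}\sigma.\Delta:\sigma\to^r\tau$ if $\Gamma,x{:}\sigma\vdash_\Sigma\Delta:\tau$ and $|\Delta|=_\eta x$; $\Delta_1@^r\Delta_2:\tau$ if $\Delta_1:\sigma\to^r\tau$, $\Delta_2:\sigma$; $\langle\Delta_1,\Delta_2\rangle:\sigma\cap\tau$ if $\Delta_1:\sigma$, $\Delta_2:\tau$, $|\Delta_1|=_\eta|\Delta_2|$; $pr_l\Delta:\sigma$, $pr_r\Delta:\tau$ if $\Delta:\sigma\cap\tau$; $in_l^\tau\Delta:\sigma\cup\tau$ if $\Delta:\sigma$ and $\sigma\cup\tau:\mathrm{Type}$; $in_r^\sigma\Delta:\sigma\cup\tau$ if $\Delta:\tau$ and $\sigma\cup\tau:\mathrm{Type}$; $[\Delta_1,\Delta_2]:\Pi x{:}\sigma\cup\tau.\rho$ if $\Delta_1:\Pi y{:}\sigma.\rho[in_l^\tau y/x]$, $\Delta_2:\Pi y{:}\tau.\rho[in_r^\sigma y/x]$, $|\Delta_1|=_\eta|\Delta_2|$, $\Gamma,x{:}\sigma\cup\tau\vdash_\Sigma\rho:\mathrm{Type}$; conversion: $\Delta:\tau$ if $\Delta:\sigma$, $\Gamma\vdash_\Sigma\tau:\mathrm{Type}$,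 $\sigma=_\Delta\tau$ (all judgements in the same $\Gamma$, $\Sigma$ unless stated). A term is strongly normalizing if it has no infinite $\to_\Delta$-reduction sequence; a pure $\lambda$-term is strongly normalizing if it has no infinite $\beta$-reduction sequence. *)

theory Defs
  imports Main
begin

text \<open>
  Terms up to alpha-conversion are represented with de Bruijn indices: every binder
  (\<open>LAbs\<close>, \<open>Lam\<close>, \<open>RLam\<close>, \<open>FPi\<close>, \<open>KPi\<close> below) binds index 0 of its last argument, and
  a variable in scope of no binder refers to a position of the ambient context.
  Family constants and object constants live in two disjoint countable name spaces.
\<close>

section \<open>Pure lambda-terms\<close>

datatype lterm =
    LVar nat
  | LConst nat
  | LAbs lterm
  | LApp lterm lterm

primrec lift_l :: "lterm \<Rightarrow> nat \<Rightarrow> lterm" where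
  "lift_l (LVar i) k = (if i < k then LVar i else LVar (Suc i))"
| "lift_l (LConst c) k = LConst c"
| "lift_l (LAbs t) k = LAbs (lift_l t (Suc k))"
| "lift_l (LApp t u) k = LApp (lift_l t k) (lift_l u k)"

text \<open>\<open>subst_l t s k\<close> replaces index \<open>k\<close> by \<open>s\<close> and closes the gap at \<open>k\<close>.\<close>

primrec subst_l :: "lterm \<Rightarrow> lterm \<Rightarrow> nat \<Rightarrow> lterm" where
  "subst_l (LVar i) s k = (if k < i then LVar (i - 1) else if i = k then s else LVar i)"
| "subst_l (LConst c) s k = LConst c"
| "subst_l (LAbs t) s k = LAbs (subst_l t (lift_l s 0) (Suc k))"
| "subst_l (LApp t u) s k = LApp (subst_l t s k) (subst_l u s k)"

inductive beta :: "lterm \<Rightarrow> lterm \<Rightarrow> bool" where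
  "beta (LApp (LAbs t) u) (subst_l t u 0)"
| "beta t t' \<Longrightarrow> beta (LAbs t) (LAbs t')"
| "beta t t' \<Longrightarrow> beta (LApp t u) (LApp t' u)"
| "beta u u' \<Longrightarrow> beta (LApp t u) (LApp t u')"

text \<open>In the contraction rule, \<open>lift_l t 0\<close> says that the bound variable is not free in the
  function part.\<close>

inductive eta :: "lterm \<Rightarrow> lterm \<Rightarrow> bool" where
  "eta (LAbs (LApp (lift_l t 0) (LVar 0))) t"
| "eta t t' \<Longrightarrow> eta (LAbs t) (LAbs t')"
| "eta t t' \<Longrightarrow> eta (LApp t u) (LApp t' u)"
| "eta u u' \<Longrightarrow> eta (LApp t u) (LApp t u')"

abbreviation eta_eq :: "lterm \<Rightarrow> lterm \<Rightarrow> bool" (infix "=\<^sub>\<eta>" 50) where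
  "eta_eq \<equiv> equivclp eta"

section \<open>Pseudo-terms\<close>

text \<open>\<open>RArr\<close>, \<open>RLam\<close>, \<open>RApp\<close> are the relevant arrow, abstraction and application;
  \<open>SPair\<close> and \<open>CoPair\<close> are the strong pair and the strong co-pair; the family argument of
  \<open>InL\<close> and \<open>InR\<close> is the type annotation, i.e. the other component of the union.\<close>

datatype fam =
    FConst nat
  | FPi fam fam
  | FApp fam obj
  | RArr fam fam
  | FInter fam fam
  | FUnion fam fam
and obj =
    Const nat
  | Var nat
  | Lam fam obj
  | App obj obj
  | RLam fam obj
  | RApp obj obj
  | SPair obj obj
  | CoPair obj obj
  | PrL obj
  | PrR obj
  | InL fam obj
  | InR fam obj

datatype kind =
    KType
  | KPi fam kind

primrec lift_f :: "fam \<Rightarrow> nat \<Rightarrow> fam" and lift_o :: "obj \<Rightarrow> nat \<Rightarrow> obj" where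
  "lift_f (FConst a) k = FConst a"
| "lift_f (FPi A B) k = FPi (lift_f A k) (lift_f B (Suc k))"
| "lift_f (FApp A D) k = FApp (lift_f A k) (lift_o D k)"
| "lift_f (RArr A B) k = RArr (lift_f A k) (lift_f B k)"
| "lift_f (FInter A B) k = FInter (lift_f A k) (lift_f B k)"
| "lift_f (FUnion A B) k = FUnion (lift_f A k) (lift_f B k)"
| "lift_o (Const c) k = Const c"
| "lift_o (Var i) k = (if i < k then Var i else Var (Suc i))"
| "lift_o (Lam A D) k = Lam (lift_f A k) (lift_o D (Suc k))"
| "lift_o (App D E) k = App (lift_o D k) (lift_o E k)"
| "lift_o (RLam A D) k = RLam (lift_f A k) (lift_o D (Suc k))"
| "lift_o (RApp D E) k = RApp (lift_o D k) (lift_o E k)"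
| "lift_o (SPair D E) k = SPair (lift_o D k) (lift_o E k)"
| "lift_o (CoPair D E) k = CoPair (lift_o D k) (lift_o E k)"
| "lift_o (PrL D) k = PrL (lift_o D k)"
| "lift_o (PrR D) k = PrR (lift_o D k)"
| "lift_o (InL A D) k = InL (lift_f A k) (lift_o D k)"
| "lift_o (InR A D) k = InR (lift_f A k) (lift_o D k)"

primrec subst_f :: "fam \<Rightarrow> obj \<Rightarrow> nat \<Rightarrow> fam" and subst_o :: "obj \<Rightarrow> obj \<Rightarrow> nat \<Rightarrow> obj" where
  "subst_f (FConst a) S k = FConst a"
| "subst_f (FPi A B) S k = FPi (subst_f A S k) (subst_f B (lift_o S 0) (Suc k))"
| "subst_f (FApp A D) S k = FApp (subst_f A S k) (subst_o D S k)"
| "subst_f (RArr A B) S k = RArr (subst_f A S k) (subst_f B S k)"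
| "subst_f (FInter A B) S k = FInter (subst_f A S k) (subst_f B S k)"
| "subst_f (FUnion A B) S k = FUnion (subst_f A S k) (subst_f B S k)"
| "subst_o (Const c) S k = Const c"
| "subst_o (Var i) S k = (if k < i then Var (i - 1) else if i = k then S else Var i)"
| "subst_o (Lam A D) S k = Lam (subst_f A S k) (subst_o D (lift_o S 0) (Suc k))"
| "subst_o (App D E) S k = App (subst_o D S k) (subst_o E S k)"
| "subst_o (RLam A D) S k = RLam (subst_f A S k) (subst_o D (lift_o S 0) (Suc k))"
| "subst_o (RApp D E) S k = RApp (subst_o D S k) (subst_o E S k)"
| "subst_o (SPair D E) S k = SPair (subst_o D S k) (subst_o E S k)"
| "subst_o (CoPair D E) S k = CoPair (subst_o D S k) (subst_o E S k)"
| "subst_o (PrL D) S k = PrL (subst_o D S k)"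
| "subst_o (PrR D) S k = PrR (subst_o D S k)"
| "subst_o (InL A D) S k = InL (subst_f A S k) (subst_o D S k)"
| "subst_o (InR A D) S k = InR (subst_f A S k) (subst_o D S k)"

primrec subst_k :: "kind \<Rightarrow> obj \<Rightarrow> nat \<Rightarrow> kind" where
  "subst_k KType S k = KType"
| "subst_k (KPi A K) S k = KPi (subst_f A S k) (subst_k K (lift_o S 0) (Suc k))"

section \<open>Essence\<close>

fun essence :: "obj \<Rightarrow> lterm" where
  "essence (Const c) = LConst c"
| "essence (Var i) = LVar i"
| "essence (Lam A D) = LAbs (essence D)"
| "essence (App D E) = LApp (essence D) (essence E)"
| "essence (RLam A D) = LAbs (essence D)"
| "essence (RApp D E) = essence E"
| "essence (SPair D E) = essence D"
| "essence (CoPair D E) = essence D"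
| "essence (PrL D) = essence D"
| "essence (PrR D) = essence D"
| "essence (InL A D) = essence D"
| "essence (InR A D) = essence D"

text \<open>The convention that pairs and co-pairs have components with identical essences. It is
  kept as a predicate, separate from the typing rules, which only ask for
  eta-equal essences.\<close>

primrec coherent_f :: "fam \<Rightarrow> bool" and coherent_o :: "obj \<Rightarrow> bool" where
  "coherent_f (FConst a) = True"
| "coherent_f (FPi A B) = (coherent_f A \<and> coherent_f B)"
| "coherent_f (FApp A D) = (coherent_f A \<and> coherent_o D)"
| "coherent_f (RArr A B) = (coherent_f A \<and> coherent_f B)"
| "coherent_f (FInter A B) = (coherent_f A \<and> coherent_f B)"
| "coherent_f (FUnion A B) = (coherent_f A \<and> coherent_f B)"
| "coherent_o (Const c) = True"
| "coherent_o (Var i) = True"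
| "coherent_o (Lam A D) = (coherent_f A \<and> coherent_o D)"
| "coherent_o (App D E) = (coherent_o D \<and> coherent_o E)"
| "coherent_o (RLam A D) = (coherent_f A \<and> coherent_o D)"
| "coherent_o (RApp D E) = (coherent_o D \<and> coherent_o E)"
| "coherent_o (SPair D E) = (coherent_o D \<and> coherent_o E \<and> essence D = essence E)"
| "coherent_o (CoPair D E) = (coherent_o D \<and> coherent_o E \<and> essence D = essence E)"
| "coherent_o (PrL D) = coherent_o D"
| "coherent_o (PrR D) = coherent_o D"
| "coherent_o (InL A D) = (coherent_f A \<and> coherent_o D)"
| "coherent_o (InR A D) = (coherent_f A \<and> coherent_o D)"

primrec coherent_k :: "kind \<Rightarrow> bool" where
  "coherent_k KType = True"
| "coherent_k (KPi A K) = (coherent_f A \<and> coherent_k K)"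

section \<open>Reduction and conversion\<close>

inductive red_f :: "fam \<Rightarrow> fam \<Rightarrow> bool" and red_o :: "obj \<Rightarrow> obj \<Rightarrow> bool" where
  beta: "red_o (App (Lam A D) E) (subst_o D E 0)"
| prl: "red_o (PrL (SPair D E)) D"
| prr: "red_o (PrR (SPair D E)) E"
| inl: "red_o (App (CoPair D E) (InL A F)) (App D F)"
| inr: "red_o (App (CoPair D E) (InR A F)) (App E F)"
| rbeta: "red_o (RApp (RLam A D) E) (subst_o D E 0)"
| "red_f A A' \<Longrightarrow> red_f (FPi A B) (FPi A' B)"
| "red_f B B' \<Longrightarrow> red_f (FPi A B) (FPi A B')"
| "red_f A A' \<Longrightarrow> red_f (FApp A D) (FApp A' D)"
| "red_o D D' \<Longrightarrow> red_f (FApp A D) (FApp A D')"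
| "red_f A A' \<Longrightarrow> red_f (RArr A B) (RArr A' B)"
| "red_f B B' \<Longrightarrow> red_f (RArr A B) (RArr A B')"
| "red_f A A' \<Longrightarrow> red_f (FInter A B) (FInter A' B)"
| "red_f B B' \<Longrightarrow> red_f (FInter A B) (FInter A B')"
| "red_f A A' \<Longrightarrow> red_f (FUnion A B) (FUnion A' B)"
| "red_f B B' \<Longrightarrow> red_f (FUnion A B) (FUnion A B')"
| "red_f A A' \<Longrightarrow> red_o (Lam A D) (Lam A' D)"
| "red_o D D' \<Longrightarrow> red_o (Lam A D) (Lam A D')"
| "red_o D D' \<Longrightarrow> red_o (App D E) (App D' E)"
| "red_o E E' \<Longrightarrow> red_o (App D E) (App D E')"
| "red_f A A' \<Longrightarrow> red_o (RLam A D) (RLam A' D)"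
| "red_o D D' \<Longrightarrow> red_o (RLam A D) (RLam A D')"
| "red_o D D' \<Longrightarrow> red_o (RApp D E) (RApp D' E)"
| "red_o E E' \<Longrightarrow> red_o (RApp D E) (RApp D E')"
| "red_o D D' \<Longrightarrow> red_o E E' \<Longrightarrow> essence D' = essence E' \<Longrightarrow>
     red_o (SPair D E) (SPair D' E')"
| "red_o D D' \<Longrightarrow> red_o E E' \<Longrightarrow> essence D' = essence E' \<Longrightarrow>
     red_o (CoPair D E) (CoPair D' E')"
| "red_o D D' \<Longrightarrow> red_o (PrL D) (PrL D')"
| "red_o D D' \<Longrightarrow> red_o (PrR D) (PrR D')"
| "red_f A A' \<Longrightarrow> red_o (InL A D) (InL A' D)"
| "red_o D D' \<Longrightarrow> red_o (InL A D) (InL A D')"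
| "red_f A A' \<Longrightarrow> red_o (InR A D) (InR A' D)"
| "red_o D D' \<Longrightarrow> red_o (InR A D) (InR A D')"

inductive red_k :: "kind \<Rightarrow> kind \<Rightarrow> bool" where
  "red_f A A' \<Longrightarrow> red_k (KPi A K) (KPi A' K)"
| "red_k K K' \<Longrightarrow> red_k (KPi A K) (KPi A K')"

abbreviation conv_f :: "fam \<Rightarrow> fam \<Rightarrow> bool" where "conv_f \<equiv> equivclp red_f"
abbreviation conv_k :: "kind \<Rightarrow> kind \<Rightarrow> bool" where "conv_k \<equiv> equivclp red_k"

definition strongly_normalizing :: "('a \<Rightarrow> 'a \<Rightarrow> bool) \<Rightarrow> 'a \<Rightarrow> bool" where
  "strongly_normalizing R t \<longleftrightarrow> \<not> (\<exists>f. f (0::nat) = t \<and> (\<forall>i. R (f i) (f (Suc i))))"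

section \<open>Judgements\<close>

datatype decl =
    FDecl nat kind
  | ODecl nat fam

text \<open>Signatures and contexts are lists with the most recent declaration at the head.
  A free variable is the index of its declaration in the context, so the
  freshness condition for context extension holds by construction; a type stored at
  position \<open>i\<close> is weakened by \<open>Suc i\<close> when it is looked up. Types and kinds stored in a
  signature are closed and need no weakening.\<close>

type_synonym sig = "decl list"
type_synonym ctx = "fam list"

definition fdom :: "sig \<Rightarrow> nat set" where
  "fdom S = {a. \<exists>K. FDecl a K \<in> set S}"

definition odom :: "sig \<Rightarrow> nat set" where
  "odom S = {c. \<exists>A. ODecl c A \<in> set S}"

definition coherent_sig :: "sig \<Rightarrow> bool" where
  "coherent_sig S \<longleftrightarrow>
    (\<forall>a K. FDecl a K \<in> set S \<longrightarrow> coherent_k K) \<and> (\<forall>c A. ODecl c A \<in> set S \<longrightarrow> coherent_f A)"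

definition coherent_ctx :: "ctx \<Rightarrow> bool" where
  "coherent_ctx G \<longleftrightarrow> (\<forall>A \<in> set G. coherent_f A)"

definition lookup :: "ctx \<Rightarrow> nat \<Rightarrow> fam" where
  "lookup G i = ((\<lambda>A. lift_f A 0) ^^ Suc i) (G ! i)"

text \<open>Arguments are ordered signature, context, subject, classifier. Two rules need an encoding
  remark. In \<open>o_rlam\<close> the codomain of a relevant arrow does not bind the variable, hence
  the body has type \<open>lift_f B 0\<close>. In \<open>o_copair\<close> the family \<open>C\<close> lives in the context extended
  by \<open>x\<close> of type \<open>FUnion A B\<close>; \<open>subst_f (lift_f C 1) (InL (lift_f B 0) (Var 0)) 0\<close> is the family
  obtained from \<open>C\<close> by substituting the left injection of \<open>y\<close> for \<open>x\<close>, in the context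
  extended by \<open>y\<close> of type \<open>A\<close> instead.\<close>

inductive
  is_sig :: "sig \<Rightarrow> bool" and
  is_ctx :: "sig \<Rightarrow> ctx \<Rightarrow> bool" and
  is_kind :: "sig \<Rightarrow> ctx \<Rightarrow> kind \<Rightarrow> bool" and
  has_kind :: "sig \<Rightarrow> ctx \<Rightarrow> fam \<Rightarrow> kind \<Rightarrow> bool" and
  has_type :: "sig \<Rightarrow> ctx \<Rightarrow> obj \<Rightarrow> fam \<Rightarrow> bool"
where
  sig_empty: "is_sig []"
| sig_fam: "is_sig S \<Longrightarrow> is_kind S [] K \<Longrightarrow> a \<notin> fdom S \<Longrightarrow> is_sig (FDecl a K # S)"
| sig_obj: "is_sig S \<Longrightarrow> has_kind S [] A KType \<Longrightarrow> c \<notin> odom S \<Longrightarrow> is_sig (ODecl c A # S)"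
| ctx_empty: "is_sig S \<Longrightarrow> is_ctx S []"
| ctx_ext: "is_ctx S G \<Longrightarrow> has_kind S G A KType \<Longrightarrow> is_ctx S (A # G)"
| k_type: "is_ctx S G \<Longrightarrow> is_kind S G KType"
| k_pi: "is_kind S (A # G) K \<Longrightarrow> is_kind S G (KPi A K)"
| f_const: "is_ctx S G \<Longrightarrow> FDecl a K \<in> set S \<Longrightarrow> has_kind S G (FConst a) K"
| f_pi: "has_kind S (A # G) B KType \<Longrightarrow> has_kind S G (FPi A B) KType"
| f_app: "has_kind S G A (KPi B K) \<Longrightarrow> has_type S G D B \<Longrightarrow>
     has_kind S G (FApp A D) (subst_k K D 0)"
| f_rarr: "has_kind S G A KType \<Longrightarrow> has_kind S G B KType \<Longrightarrow> has_kind S G (RArr A B) KType"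
| f_inter: "has_kind S G A KType \<Longrightarrow> has_kind S G B KType \<Longrightarrow> has_kind S G (FInter A B) KType"
| f_union: "has_kind S G A KType \<Longrightarrow> has_kind S G B KType \<Longrightarrow> has_kind S G (FUnion A B) KType"
| f_conv: "has_kind S G A K1 \<Longrightarrow> is_kind S G K2 \<Longrightarrow> conv_k K1 K2 \<Longrightarrow> has_kind S G A K2"
| o_const: "is_ctx S G \<Longrightarrow> ODecl c A \<in> set S \<Longrightarrow> has_type S G (Const c) A"
| o_var: "is_ctx S G \<Longrightarrow> i < length G \<Longrightarrow> has_type S G (Var i) (lookup G i)"
| o_lam: "has_type S (A # G) D B \<Longrightarrow> has_type S G (Lam A D) (FPi A B)"
| o_app: "has_type S G D (FPi A B) \<Longrightarrow> has_type S G E A \<Longrightarrow>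
     has_type S G (App D E) (subst_f B E 0)"
| o_rlam: "has_type S (A # G) D (lift_f B 0) \<Longrightarrow> essence D =\<^sub>\<eta> LVar 0 \<Longrightarrow>
     has_type S G (RLam A D) (RArr A B)"
| o_rapp: "has_type S G D (RArr A B) \<Longrightarrow> has_type S G E A \<Longrightarrow> has_type S G (RApp D E) B"
| o_pair: "has_type S G D A \<Longrightarrow> has_type S G E B \<Longrightarrow> essence D =\<^sub>\<eta> essence E \<Longrightarrow>
     has_type S G (SPair D E) (FInter A B)"
| o_prl: "has_type S G D (FInter A B) \<Longrightarrow> has_type S G (PrL D) A"
| o_prr: "has_type S G D (FInter A B) \<Longrightarrow> has_type S G (PrR D) B"
| o_inl: "has_type S G D A \<Longrightarrow> has_kind S G (FUnion A B) KType \<Longrightarrow>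
     has_type S G (InL B D) (FUnion A B)"
| o_inr: "has_type S G D B \<Longrightarrow> has_kind S G (FUnion A B) KType \<Longrightarrow>
     has_type S G (InR A D) (FUnion A B)"
| o_copair:
    "has_type S G D (FPi A (subst_f (lift_f C 1) (InL (lift_f B 0) (Var 0)) 0)) \<Longrightarrow>
     has_type S G E (FPi B (subst_f (lift_f C 1) (InR (lift_f A 0) (Var 0)) 0)) \<Longrightarrow>
     essence D =\<^sub>\<eta> essence E \<Longrightarrow>
     has_kind S (FUnion A B # G) C KType \<Longrightarrow>
     has_type S G (CoPair D E) (FPi (FUnion A B) C)"
| o_conv: "has_type S G D A \<Longrightarrow> has_kind S G B KType \<Longrightarrow> conv_f A B \<Longrightarrow> has_type S G D B"

end

theory Submission
  imports Defs
begin

text \<open>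
  Part (1): forgetting the objects inside a family leaves a simple type with two kinds of arrow,
  products and sums. Since there is no abstraction at the level of families, this type is invariant
  under substitution and conversion, and Tait's reducibility method applies to it.

  Part (2): a strongly normalizing term has a strict intersection type, by induction on its
  reducts and subterms with subject expansion along head reduction. In such a derivation an
  intersection is introduced by a strong pair and eliminated by projections, none of which
  changes the essence.
\<close>

section \<open>Strong normalization as accessibility\<close>

text \<open>The essence gives no termination measure: contracting \<open>PrL (SPair D E)\<close> or
  reducing inside an annotation leaves it unchanged. Normalization is therefore proved on the
  annotated pseudo-terms themselves, and as families contain objects and objects contain families,
  both are treated in one induction over derivations. For the converse, the target calculus has no
  universal type, so an argument that a reduction discards must still have a type of its own. This
  is why typability is shown for all subterms at once.\<close>

definition sn :: "('a \<Rightarrow> 'a \<Rightarrow> bool) \<Rightarrow> 'a \<Rightarrow> bool" where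
  "sn R = Wellfounded.accp (R\<inverse>\<inverse>)"

lemma snI: "(\<And>y. R x y \<Longrightarrow> sn R y) \<Longrightarrow> sn R x"
  unfolding sn_def by (rule accp.accI) simp

lemma snD: "sn R x \<Longrightarrow> R x y \<Longrightarrow> sn R y"
  unfolding sn_def by (erule accp_downward) simp

lemma sn_induct [consumes 1, case_names step]:
  assumes "sn R x" and "\<And>x. sn R x \<Longrightarrow> (\<And>y. R x y \<Longrightarrow> P y) \<Longrightarrow> P x"
  shows "P x"
proof -
  have "Wellfounded.accp (R\<inverse>\<inverse>) x" using assms(1) by (simp add: sn_def)
  then show ?thesis
  proof (induction rule: accp.induct)
    case (accI x)
    have "sn R x" using accI(1) unfolding sn_def by (rule accp.accI)
    then show ?case by (rule assms(2)) (use accI(2) in simp)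
  qed
qed

text \<open>From a term that is not accessible, choice picks an inaccessible reduct again and again,
  which gives an infinite sequence. Accessibility is the working form because it supports induction
  on reducts.\<close>

lemma strongly_normalizing_iff_sn: "strongly_normalizing R t \<longleftrightarrow> sn R t"
proof
  assume *: "strongly_normalizing R t"
  show "sn R t"
  proof (rule ccontr)
    assume t: "\<not> sn R t"
    have "\<forall>x. \<exists>y. \<not> sn R x \<longrightarrow> R x y \<and> \<not> sn R y"
      using snI by metis
    then obtain g where g: "\<And>x. \<not> sn R x \<Longrightarrow> R x (g x) \<and> \<not> sn R (g x)"
      by metis
    have "\<not> sn R ((g ^^ n) t)" for n
      by (induction n) (auto simp: t g)
    then have "\<forall>i. R ((g ^^ i) t) ((g ^^ Suc i) t)"
      using g by simp
    moreover have "(g ^^ 0) t = t" by simp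
    ultimately show False
      using * exI[of "\<lambda>f. f 0 = t \<and> (\<forall>i. R (f i) (f (Suc i)))" "\<lambda>i. (g ^^ i) t"]
      unfolding strongly_normalizing_def by blast
  qed
next
  assume "sn R t"
  then have "\<forall>f. f (0::nat) = t \<longrightarrow> \<not> (\<forall>i. R (f i) (f (Suc i)))"
  proof (induction rule: sn_induct)
    case (step x)
    show ?case
    proof (intro allI impI notI)
      fix f :: "nat \<Rightarrow> 'a" assume "f 0 = x" "\<forall>i. R (f i) (f (Suc i))"
      then show False
        using step.IH[of "f (Suc 0)"] by (auto dest: spec[where x = "\<lambda>i. f (Suc i)"])
    qed
  qed
  then show "strongly_normalizing R t"
    unfolding strongly_normalizing_def by auto
qed

text \<open>Every reduction sequence from \<open>x\<close> is carried by \<open>g\<close> to one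
  from \<open>g x\<close>. It is used with \<open>g\<close> a term context or a
  substitution.\<close>

lemma sn_reflect:
  assumes "sn R' (g x)" and "\<And>x y. R x y \<Longrightarrow> R' (g x) (g y)"
  shows "sn R x"
  using assms(1)
proof (induction "g x" arbitrary: x rule: sn_induct)
  case step
  show ?case by (rule snI) (rule step(2)[OF assms(2)])
qed

text \<open>Nested induction on both arguments. It serves constructors that are never the root of a
  redex, where each step is a step in one argument.\<close>

lemma sn_map2:
  assumes "sn R x" "sn R' y"
    and "\<And>x y z. Q (f x y) z \<Longrightarrow> (\<exists>x'. z = f x' y \<and> R x x') \<or> (\<exists>y'. z = f x y' \<and> R' y y')"
  shows "sn Q (f x y)"
  using assms(1,2)
proof (induction arbitrary: y rule: sn_induct)
  case (step x)
  note x = step.IH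
  from step.prems show ?case
  proof (induction rule: sn_induct)
    case (step y)
    show ?case
      by (rule snI) (use step x assms(3) in blast)
  qed
qed

section \<open>Parallel substitution\<close>

text \<open>Simultaneous maps are used because their composition laws carry no index conditions;
  lifting and single substitution are recovered below through \<open>lft k\<close> and
  \<open>sng S k\<close>. Renamings come first since \<open>ups\<close> weakens with them.\<close>

definition upr :: "(nat \<Rightarrow> nat) \<Rightarrow> nat \<Rightarrow> nat" where
  "upr r = case_nat 0 (\<lambda>j. Suc (r j))"

primrec ren_f :: "fam \<Rightarrow> (nat \<Rightarrow> nat) \<Rightarrow> fam" and ren_o :: "obj \<Rightarrow> (nat \<Rightarrow> nat) \<Rightarrow> obj" where
  "ren_f (FConst a) r = FConst a"
| "ren_f (FPi A B) r = FPi (ren_f A r) (ren_f B (upr r))"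
| "ren_f (FApp A D) r = FApp (ren_f A r) (ren_o D r)"
| "ren_f (RArr A B) r = RArr (ren_f A r) (ren_f B r)"
| "ren_f (FInter A B) r = FInter (ren_f A r) (ren_f B r)"
| "ren_f (FUnion A B) r = FUnion (ren_f A r) (ren_f B r)"
| "ren_o (Const c) r = Const c"
| "ren_o (Var i) r = Var (r i)"
| "ren_o (Lam A D) r = Lam (ren_f A r) (ren_o D (upr r))"
| "ren_o (App D E) r = App (ren_o D r) (ren_o E r)"
| "ren_o (RLam A D) r = RLam (ren_f A r) (ren_o D (upr r))"
| "ren_o (RApp D E) r = RApp (ren_o D r) (ren_o E r)"
| "ren_o (SPair D E) r = SPair (ren_o D r) (ren_o E r)"
| "ren_o (CoPair D E) r = CoPair (ren_o D r) (ren_o E r)"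
| "ren_o (PrL D) r = PrL (ren_o D r)"
| "ren_o (PrR D) r = PrR (ren_o D r)"
| "ren_o (InL A D) r = InL (ren_f A r) (ren_o D r)"
| "ren_o (InR A D) r = InR (ren_f A r) (ren_o D r)"

definition ups :: "(nat \<Rightarrow> obj) \<Rightarrow> nat \<Rightarrow> obj" where
  "ups s = case_nat (Var 0) (\<lambda>j. ren_o (s j) Suc)"

primrec psubst_f :: "fam \<Rightarrow> (nat \<Rightarrow> obj) \<Rightarrow> fam" and psubst_o :: "obj \<Rightarrow> (nat \<Rightarrow> obj) \<Rightarrow> obj" where
  "psubst_f (FConst a) s = FConst a"
| "psubst_f (FPi A B) s = FPi (psubst_f A s) (psubst_f B (ups s))"
| "psubst_f (FApp A D) s = FApp (psubst_f A s) (psubst_o D s)"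
| "psubst_f (RArr A B) s = RArr (psubst_f A s) (psubst_f B s)"
| "psubst_f (FInter A B) s = FInter (psubst_f A s) (psubst_f B s)"
| "psubst_f (FUnion A B) s = FUnion (psubst_f A s) (psubst_f B s)"
| "psubst_o (Const c) s = Const c"
| "psubst_o (Var i) s = s i"
| "psubst_o (Lam A D) s = Lam (psubst_f A s) (psubst_o D (ups s))"
| "psubst_o (App D E) s = App (psubst_o D s) (psubst_o E s)"
| "psubst_o (RLam A D) s = RLam (psubst_f A s) (psubst_o D (ups s))"
| "psubst_o (RApp D E) s = RApp (psubst_o D s) (psubst_o E s)"
| "psubst_o (SPair D E) s = SPair (psubst_o D s) (psubst_o E s)"
| "psubst_o (CoPair D E) s = CoPair (psubst_o D s) (psubst_o E s)"
| "psubst_o (PrL D) s = PrL (psubst_o D s)"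
| "psubst_o (PrR D) s = PrR (psubst_o D s)"
| "psubst_o (InL A D) s = InL (psubst_f A s) (psubst_o D s)"
| "psubst_o (InR A D) s = InR (psubst_f A s) (psubst_o D s)"

primrec psubst_k :: "kind \<Rightarrow> (nat \<Rightarrow> obj) \<Rightarrow> kind" where
  "psubst_k KType s = KType"
| "psubst_k (KPi A K) s = KPi (psubst_f A s) (psubst_k K (ups s))"

lemma upr_upr: "upr r' (upr r i) = upr (\<lambda>i. r' (r i)) i"
  by (simp add: upr_def split: nat.split)

lemma ren_ren:
  "ren_f (ren_f A r) r' = ren_f A (\<lambda>i. r' (r i))"
  "ren_o (ren_o D r) r' = ren_o D (\<lambda>i. r' (r i))"
  by (induction A and D arbitrary: r r' and r r') (simp_all add: upr_upr)

lemma ups_upr: "ups s (upr r i) = ups (\<lambda>i. s (r i)) i"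
  by (simp add: upr_def ups_def split: nat.split)

lemma psubst_ren:
  "psubst_f (ren_f A r) s = psubst_f A (\<lambda>i. s (r i))"
  "psubst_o (ren_o D r) s = psubst_o D (\<lambda>i. s (r i))"
  by (induction A and D arbitrary: r s and r s) (simp_all add: ups_upr)

lemma ren_ups: "ren_o (ups s i) (upr r) = ups (\<lambda>i. ren_o (s i) r) i"
  by (simp add: upr_def ups_def ren_ren split: nat.split)

lemma ren_psubst:
  "ren_f (psubst_f A s) r = psubst_f A (\<lambda>i. ren_o (s i) r)"
  "ren_o (psubst_o D s) r = psubst_o D (\<lambda>i. ren_o (s i) r)"
  by (induction A and D arbitrary: r s and r s) (simp_all add: ren_ups)

lemma psubst_ups: "psubst_o (ups s i) (ups s') = ups (\<lambda>i. psubst_o (s i) s') i"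
  by (simp add: ups_def psubst_ren ren_psubst split: nat.split)

lemma psubst_psubst:
  "psubst_f (psubst_f A s) s' = psubst_f A (\<lambda>i. psubst_o (s i) s')"
  "psubst_o (psubst_o D s) s' = psubst_o D (\<lambda>i. psubst_o (s i) s')"
  by (induction A and D arbitrary: s s' and s s') (simp_all add: psubst_ups)

lemma psubst_k_psubst_k: "psubst_k (psubst_k K s) s' = psubst_k K (\<lambda>i. psubst_o (s i) s')"
  by (induction K arbitrary: s s') (simp_all add: psubst_ups psubst_psubst)

lemma ups_Var: "ups Var = Var"
  by (rule ext) (simp add: ups_def split: nat.split)

lemma psubst_Var [simp]: "psubst_f A Var = A" "psubst_o D Var = D"
  by (induction A and D) (simp_all add: ups_Var)

lemma psubst_k_Var [simp]: "psubst_k K Var = K"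
  by (induction K) (simp_all add: ups_Var)

definition lft :: "nat \<Rightarrow> nat \<Rightarrow> nat" where
  "lft k i = (if i < k then i else Suc i)"

lemma lft_0 [simp]: "lft 0 = Suc"
  by (rule ext) (simp add: lft_def)

lemma upr_lft: "upr (lft k) = lft (Suc k)"
  by (rule ext) (simp add: upr_def lft_def split: nat.split)

lemma lift_eq_ren: "lift_f A k = ren_f A (lft k)" "lift_o D k = ren_o D (lft k)"
  by (induction A and D arbitrary: k and k) (simp_all add: upr_lft, simp add: lft_def)

definition sng :: "obj \<Rightarrow> nat \<Rightarrow> nat \<Rightarrow> obj" where
  "sng S k i = (if k < i then Var (i - 1) else if i = k then S else Var i)"

lemma ups_sng: "ups (sng S k) = sng (lift_o S 0) (Suc k)"
  by (rule ext) (auto simp add: ups_def sng_def lift_eq_ren split: nat.split)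

lemma subst_eq_psubst: "subst_f A S k = psubst_f A (sng S k)" "subst_o D S k = psubst_o D (sng S k)"
  by (induction A and D arbitrary: S k and S k) (simp_all add: ups_sng, simp add: sng_def)

lemma subst_k_eq_psubst: "subst_k K S k = psubst_k K (sng S k)"
  by (induction K arbitrary: S k) (simp_all add: ups_sng subst_eq_psubst)

lemma psubst_ups_sng: "psubst_o (ups s i) (sng E 0) = case_nat E s i"
proof (cases i)
  case (Suc j)
  have "(\<lambda>i. sng E 0 (Suc i)) = Var" by (rule ext) (simp add: sng_def)
  then show ?thesis using Suc by (simp add: ups_def psubst_ren)
qed (simp add: ups_def sng_def)

text \<open>This connects the contraction of a binder that already lies under \<open>s\<close> with
  the induction hypothesis for its body in the extended context.\<close>

lemma subst_psubst_ups:
  "subst_f (psubst_f A (ups s)) E 0 = psubst_f A (case_nat E s)"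
  "subst_o (psubst_o D (ups s)) E 0 = psubst_o D (case_nat E s)"
  "subst_k (psubst_k K (ups s)) E 0 = psubst_k K (case_nat E s)"
  by (simp_all add: subst_eq_psubst subst_k_eq_psubst psubst_psubst psubst_k_psubst_k psubst_ups_sng)

lemma subst_subst:
  "subst_o (subst_o D E 0) S k = subst_o (subst_o D (lift_o S 0) (Suc k)) (subst_o E S k) 0"
proof -
  have "(\<lambda>i. psubst_o (sng E 0 i) (sng S k)) = case_nat (psubst_o E (sng S k)) (sng S k)"
    by (rule ext) (simp add: sng_def split: nat.split)
  then show ?thesis
    by (simp add: subst_eq_psubst psubst_psubst psubst_ups_sng flip: ups_sng)
qed

section \<open>Compatibility of essence and reduction with substitution\<close>

lemma essence_lift: "essence (lift_o D k) = lift_l (essence D) k"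
  by (induction D arbitrary: k rule: essence.induct) simp_all

lemma essence_subst: "essence (subst_o D S k) = subst_l (essence D) (essence S) k"
  by (induction D arbitrary: S k rule: essence.induct) (simp_all add: essence_lift)

text \<open>The beta cases rest on \<open>subst_subst\<close>; in the pair and co-pair cases the
  side condition on essences survives by \<open>essence_subst\<close>.\<close>

lemma red_subst:
  "red_f A A' \<Longrightarrow> red_f (subst_f A S k) (subst_f A' S k)"
  "red_o D D' \<Longrightarrow> red_o (subst_o D S k) (subst_o D' S k)"
  by (induction arbitrary: S k and S k rule: red_f_red_o.inducts)
    (simp_all add: subst_subst essence_subst red_f_red_o.intros)

lemma red_k_subst: "red_k K K' \<Longrightarrow> red_k (subst_k K S k) (subst_k K' S k)"
  by (induction arbitrary: S k rule: red_k.induct) (simp_all add: red_k.intros red_subst)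

lemma sn_subst:
  "sn red_f (subst_f A S k) \<Longrightarrow> sn red_f A"
  "sn red_o (subst_o D S k) \<Longrightarrow> sn red_o D"
  "sn red_k (subst_k K S k) \<Longrightarrow> sn red_k K"
  by (erule sn_reflect, rule red_subst red_k_subst, assumption)+

section \<open>Reducibility over erased types\<close>

datatype sty =
    SBase
  | SArr sty sty
  | SRel sty sty
  | SProd sty sty
  | SSum sty sty

primrec erase :: "fam \<Rightarrow> sty" where
  "erase (FConst a) = SBase"
| "erase (FPi A B) = SArr (erase A) (erase B)"
| "erase (FApp A D) = erase A"
| "erase (RArr A B) = SRel (erase A) (erase B)"
| "erase (FInter A B) = SProd (erase A) (erase B)"
| "erase (FUnion A B) = SSum (erase A) (erase B)"

lemma erase_lift [simp]: "erase (lift_f A k) = erase A"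
  by (induction A arbitrary: k rule: fam.induct[where ?P2.0 = "\<lambda>_. True"]) simp_all

lemma erase_subst [simp]: "erase (subst_f A S k) = erase A"
  by (induction A arbitrary: S k rule: fam.induct[where ?P2.0 = "\<lambda>_. True"]) simp_all

lemma erase_red: "red_f A B \<Longrightarrow> erase A = erase B"
  by (induction rule: red_f_red_o.inducts(1)[where ?P2.0 = "\<lambda>_ _. True"]) simp_all

lemma erase_conv: "conv_f A B \<Longrightarrow> erase A = erase B"
  by (induction rule: equivclp_induct) (auto dest: erase_red)

lemma erase_lookup: "erase (lookup G i) = erase (G ! i)"
proof -
  have "erase (((\<lambda>A. lift_f A 0) ^^ n) A) = erase A" for n A
    by (induction n) simp_all
  then show ?thesis unfolding lookup_def by blast
qed

text \<open>The members need not be typed. At a sum, a clause by elimination would refer to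
  arbitrary result types and break the recursion, so the clause speaks of the injections that a term
  reduces to; normalization then has to be demanded explicitly.\<close>

primrec RED :: "sty \<Rightarrow> obj set" where
  "RED SBase = {D. sn red_o D}"
| "RED (SArr s t) = {D. \<forall>E \<in> RED s. App D E \<in> RED t}"
| "RED (SRel s t) = {D. \<forall>E \<in> RED s. RApp D E \<in> RED t}"
| "RED (SProd s t) = {D. PrL D \<in> RED s \<and> PrR D \<in> RED t}"
| "RED (SSum s t) = {D. sn red_o D \<and> (\<forall>A F. red_o\<^sup>*\<^sup>* D (InL A F) \<longrightarrow> F \<in> RED s) \<and>
     (\<forall>A F. red_o\<^sup>*\<^sup>* D (InR A F) \<longrightarrow> F \<in> RED t)}"

text \<open>Terms that form no new redex when an eliminator is put around them.\<close>

fun neutral :: "obj \<Rightarrow> bool" where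
  "neutral (Lam A D) = False"
| "neutral (RLam A D) = False"
| "neutral (SPair D E) = False"
| "neutral (CoPair D E) = False"
| "neutral (InL A D) = False"
| "neutral (InR A D) = False"
| "neutral D = True"

inductive_cases red_fE:
  "red_f (FConst a) X" "red_f (FPi A B) X" "red_f (FApp A D) X" "red_f (RArr A B) X"
  "red_f (FInter A B) X" "red_f (FUnion A B) X"

inductive_cases red_atomE: "red_o (Const c) X" "red_o (Var i) X"
inductive_cases red_LamE: "red_o (Lam A D) X"
inductive_cases red_RLamE: "red_o (RLam A D) X"
inductive_cases red_AppE: "red_o (App D E) X"
inductive_cases red_RAppE: "red_o (RApp D E) X"
inductive_cases red_SPairE: "red_o (SPair D E) X"
inductive_cases red_CoPairE: "red_o (CoPair D E) X"
inductive_cases red_PrLE: "red_o (PrL D) X"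
inductive_cases red_PrRE: "red_o (PrR D) X"
inductive_cases red_InLE: "red_o (InL A D) X"
inductive_cases red_InRE: "red_o (InR A D) X"
inductive_cases red_kE: "red_k KType X" "red_k (KPi A K) X"

section \<open>The reducibility sets as candidates\<close>

lemma not_red_atom: "\<not> red_o (Const c) X" "\<not> red_o (Var i) X"
  by (auto elim: red_atomE)

text \<open>Girard's three conditions CR1, CR2 and CR3.\<close>

definition candidate :: "obj set \<Rightarrow> bool" where
  "candidate R \<longleftrightarrow> (\<forall>D \<in> R. sn red_o D) \<and> (\<forall>D \<in> R. \<forall>D'. red_o D D' \<longrightarrow> D' \<in> R) \<and>
     (\<forall>D. neutral D \<longrightarrow> (\<forall>D'. red_o D D' \<longrightarrow> D' \<in> R) \<longrightarrow> D \<in> R)"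

lemma candidateI:
  assumes "\<And>D. D \<in> R \<Longrightarrow> sn red_o D" "\<And>D D'. D \<in> R \<Longrightarrow> red_o D D' \<Longrightarrow> D' \<in> R"
    and "\<And>D. neutral D \<Longrightarrow> (\<And>D'. red_o D D' \<Longrightarrow> D' \<in> R) \<Longrightarrow> D \<in> R"
  shows "candidate R"
  using assms unfolding candidate_def by blast

lemma candidate_sn: "candidate R \<Longrightarrow> D \<in> R \<Longrightarrow> sn red_o D"
  and candidate_red: "candidate R \<Longrightarrow> D \<in> R \<Longrightarrow> red_o D D' \<Longrightarrow> D' \<in> R"
  and candidate_neutral:
    "candidate R \<Longrightarrow> neutral D \<Longrightarrow> (\<And>D'. red_o D D' \<Longrightarrow> D' \<in> R) \<Longrightarrow> D \<in> R"
  unfolding candidate_def by blast+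

lemma candidate_Var: "candidate R \<Longrightarrow> Var i \<in> R"
  by (rule candidate_neutral) (simp_all add: not_red_atom)

text \<open>Applying \<open>D\<close> to \<open>Var 0\<close>, a member of every candidate, yields
  its normalization; the condition on neutral terms goes by induction on the normalizing argument.
  The parameter \<open>app\<close> stands for both \<open>App\<close> and
  \<open>RApp\<close>.\<close>

lemma candidate_arrow:
  assumes s: "candidate Rs" and t: "candidate Rt"
    and app: "\<And>D D' E. red_o D D' \<Longrightarrow> red_o (app D E) (app D' E)" "\<And>D E. neutral (app D E)"
    and inv: "\<And>D E X. red_o (app D E) X \<Longrightarrow> neutral D \<Longrightarrow>
      (\<exists>D'. X = app D' E \<and> red_o D D') \<or> (\<exists>E'. X = app D E' \<and> red_o E E')"
  shows "candidate {D. \<forall>E \<in> Rs. app D E \<in> Rt}"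
proof (rule candidateI)
  fix D assume "D \<in> {D. \<forall>E \<in> Rs. app D E \<in> Rt}"
  then have "app D (Var 0) \<in> Rt" using candidate_Var[OF s] by simp
  then have "sn red_o (app D (Var 0))" by (rule candidate_sn[OF t])
  then show "sn red_o D" by (rule sn_reflect) (rule app(1))
next
  fix D D' assume "D \<in> {D. \<forall>E \<in> Rs. app D E \<in> Rt}" "red_o D D'"
  then show "D' \<in> {D. \<forall>E \<in> Rs. app D E \<in> Rt}" using candidate_red[OF t] app(1) by blast
next
  fix D assume D: "neutral D" "\<And>D'. red_o D D' \<Longrightarrow> D' \<in> {D. \<forall>E \<in> Rs. app D E \<in> Rt}"
  have "app D E \<in> Rt" if "sn red_o E" "E \<in> Rs" for E
    using that
  proof (induction rule: sn_induct)
    case (step E)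
    show ?case
    proof (rule candidate_neutral[OF t app(2)])
      fix X assume "red_o (app D E) X"
      from inv[OF this D(1)] show "X \<in> Rt"
        using step D(2) candidate_red[OF s] by blast
    qed
  qed
  then show "D \<in> {D. \<forall>E \<in> Rs. app D E \<in> Rt}" using candidate_sn[OF s] by blast
qed

lemma candidate_product:
  assumes s: "candidate Rs" and t: "candidate Rt"
  shows "candidate {D. PrL D \<in> Rs \<and> PrR D \<in> Rt}"
proof (rule candidateI)
  fix D assume "D \<in> {D. PrL D \<in> Rs \<and> PrR D \<in> Rt}"
  then have "sn red_o (PrL D)" using candidate_sn[OF s] by blast
  then show "sn red_o D" by (rule sn_reflect) (rule red_f_red_o.intros)
next
  fix D D' assume "D \<in> {D. PrL D \<in> Rs \<and> PrR D \<in> Rt}" "red_o D D'"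
  then show "D' \<in> {D. PrL D \<in> Rs \<and> PrR D \<in> Rt}"
    using candidate_red[OF s] candidate_red[OF t] by (blast intro: red_f_red_o.intros)
next
  fix D assume D: "neutral D" "\<And>D'. red_o D D' \<Longrightarrow> D' \<in> {D. PrL D \<in> Rs \<and> PrR D \<in> Rt}"
  have "PrL D \<in> Rs"
    by (rule candidate_neutral[OF s]) (use D in \<open>auto elim!: red_PrLE\<close>)
  moreover have "PrR D \<in> Rt"
    by (rule candidate_neutral[OF t]) (use D in \<open>auto elim!: red_PrRE\<close>)
  ultimately show "D \<in> {D. PrL D \<in> Rs \<and> PrR D \<in> Rt}" by simp
qed

lemma candidate_RED: "candidate (RED t)"
proof (induction t)
  case SBase
  show ?case by (rule candidateI) (auto dest: snD intro: snI[of red_o])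
next
  case (SArr s t)
  show ?case unfolding RED.simps
    by (rule candidate_arrow[OF SArr.IH]) (auto intro: red_f_red_o.intros elim!: red_AppE)
next
  case (SRel s t)
  show ?case unfolding RED.simps
    by (rule candidate_arrow[OF SRel.IH]) (auto intro: red_f_red_o.intros elim!: red_RAppE)
next
  case (SProd s t)
  show ?case unfolding RED.simps by (rule candidate_product[OF SProd.IH])
next
  case (SSum s t)
  show ?case
  proof (rule candidateI)
    fix D D' assume "D \<in> RED (SSum s t)" "red_o D D'"
    then show "D' \<in> RED (SSum s t)"
      by simp (blast dest: snD intro: converse_rtranclp_into_rtranclp)
  next
    fix D assume D: "neutral D" "\<And>D'. red_o D D' \<Longrightarrow> D' \<in> RED (SSum s t)"
    \<comment> \<open>A neutral term is no injection, so the sequence has a first step, and the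
      reduct reached by it is in the set already.\<close>
    have "F \<in> RED s" if "red_o\<^sup>*\<^sup>* D (InL A F)" for A F
      using that
    proof (cases rule: converse_rtranclpE)
      case base
      then show ?thesis using D(1) by simp
    next
      case (step D')
      then show ?thesis using D(2) by auto
    qed
    moreover have "F \<in> RED t" if "red_o\<^sup>*\<^sup>* D (InR A F)" for A F
      using that
    proof (cases rule: converse_rtranclpE)
      case base
      then show ?thesis using D(1) by simp
    next
      case (step D')
      then show ?thesis using D(2) by auto
    qed
    moreover have "sn red_o D" by (rule snI) (use D(2) in simp)
    ultimately show "D \<in> RED (SSum s t)" by simp
  qed simp
qed

lemmas RED_sn = candidate_sn[OF candidate_RED]
lemmas RED_red = candidate_red[OF candidate_RED]
lemmas RED_neutral = candidate_neutral[OF candidate_RED]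
lemmas RED_Var = candidate_Var[OF candidate_RED]

section \<open>Reducibility of the term constructors\<close>

lemma RED_Const: "Const c \<in> RED t"
  by (rule RED_neutral) (simp_all add: not_red_atom)

text \<open>The application is neutral, so its one-step reducts decide. Contraction is the last
  assumption; any other step goes down in the annotation, the body or the argument, whence three
  nested inductions.\<close>

lemma RED_App_Lam:
  assumes "sn red_f A" "sn red_o D" "sn red_o E" "E \<in> RED s"
    and "\<And>E. E \<in> RED s \<Longrightarrow> subst_o D E 0 \<in> RED t"
  shows "App (Lam A D) E \<in> RED t"
  using assms
proof (induction A arbitrary: D E rule: sn_induct)
  case (step A)
  note A = step.IH
  from step.prems show ?case
  proof (induction D arbitrary: E rule: sn_induct)
    case (step D)
    note D = step.IH step.hyps
    from step.prems show ?case
    proof (induction E rule: sn_induct)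
      case (step E)
      show ?case
      proof (rule RED_neutral)
        fix X assume "red_o (App (Lam A D) E) X"
        then consider "X = subst_o D E 0"
          | (dom) A' where "X = App (Lam A' D) E" "red_f A A'"
          | (body) D' where "X = App (Lam A D') E" "red_o D D'"
          | (arg) E' where "X = App (Lam A D) E'" "red_o E E'"
          by (auto elim!: red_AppE red_LamE)
        then show "X \<in> RED t"
        proof cases
          case body
          \<comment> \<open>The assumption on instances passes to \<open>D'\<close> because
            substitution preserves the step.\<close>
          then have "subst_o D' F 0 \<in> RED t" if "F \<in> RED s" for F
            using step.prems that RED_red red_subst(2) by blast
          from D(1)[OF body(2) step.hyps step.prems(1) this] body(1) show ?thesis by simp
        next
          case dom
          from A[OF dom(2) D(2) step.hyps step.prems] dom(1) show ?thesis by simp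
        next
          case arg
          from step.IH[OF arg(2) RED_red[OF step.prems(1) arg(2)] step.prems(2)] arg(1)
          show ?thesis by simp
        qed (use step.prems in simp)
      qed simp
    qed
  qed
qed

lemma RED_RApp_RLam:
  assumes "sn red_f A" "sn red_o D" "sn red_o E" "E \<in> RED s"
    and "\<And>E. E \<in> RED s \<Longrightarrow> subst_o D E 0 \<in> RED t"
  shows "RApp (RLam A D) E \<in> RED t"
  using assms
proof (induction A arbitrary: D E rule: sn_induct)
  case (step A)
  note A = step.IH
  from step.prems show ?case
  proof (induction D arbitrary: E rule: sn_induct)
    case (step D)
    note D = step.IH step.hyps
    from step.prems show ?case
    proof (induction E rule: sn_induct)
      case (step E)
      show ?case
      proof (rule RED_neutral)
        fix X assume "red_o (RApp (RLam A D) E) X"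
        then consider "X = subst_o D E 0"
          | (dom) A' where "X = RApp (RLam A' D) E" "red_f A A'"
          | (body) D' where "X = RApp (RLam A D') E" "red_o D D'"
          | (arg) E' where "X = RApp (RLam A D) E'" "red_o E E'"
          by (auto elim!: red_RAppE red_RLamE)
        then show "X \<in> RED t"
        proof cases
          case body
          then have "subst_o D' F 0 \<in> RED t" if "F \<in> RED s" for F
            using step.prems that RED_red red_subst(2) by blast
          from D(1)[OF body(2) step.hyps step.prems(1) this] body(1) show ?thesis by simp
        next
          case dom
          from A[OF dom(2) D(2) step.hyps step.prems] dom(1) show ?thesis by simp
        next
          case arg
          from step.IH[OF arg(2) RED_red[OF step.prems(1) arg(2)] step.prems(2)] arg(1)
          show ?thesis by simp
        qed (use step.prems in simp)
      qed simp
    qed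
  qed
qed

text \<open>Normalization of the instance at \<open>Var 0\<close>, which lies in every
  \<open>RED s\<close>, reflects back to the body.\<close>

lemma RED_body_sn: "(\<And>E. E \<in> RED s \<Longrightarrow> subst_o D E 0 \<in> RED t) \<Longrightarrow> sn red_o D"
  by (rule sn_subst(2)[of D "Var 0" 0]) (auto intro: RED_sn RED_Var)

lemma RED_Lam:
  assumes "sn red_f A" and "\<And>E. E \<in> RED s \<Longrightarrow> subst_o D E 0 \<in> RED t"
  shows "Lam A D \<in> RED (SArr s t)"
  using RED_App_Lam[OF assms(1) RED_body_sn[OF assms(2)] RED_sn _ assms(2)] by simp

lemma RED_RLam:
  assumes "sn red_f A" and "\<And>E. E \<in> RED s \<Longrightarrow> subst_o D E 0 \<in> RED t"
  shows "RLam A D \<in> RED (SRel s t)"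
  using RED_RApp_RLam[OF assms(1) RED_body_sn[OF assms(2)] RED_sn _ assms(2)] by simp

text \<open>The components of a strong pair step only together, so induction on the first one
  controls both while \<open>E\<close> varies along.\<close>

lemma RED_SPair:
  assumes "D \<in> RED s" "E \<in> RED t"
  shows "SPair D E \<in> RED (SProd s t)"
proof -
  have "PrL (SPair D E) \<in> RED s \<and> PrR (SPair D E) \<in> RED t"
    using RED_sn[OF assms(1)] assms
  proof (induction arbitrary: E rule: sn_induct)
    case (step D)
    have "X \<in> RED s" if "red_o (PrL (SPair D E)) X" for X
      using that step by (auto elim!: red_PrLE red_SPairE intro: RED_red)
    moreover have "X \<in> RED t" if "red_o (PrR (SPair D E)) X" for X
      using that step by (auto elim!: red_PrRE red_SPairE intro: RED_red)
    ultimately show ?case by (auto intro: RED_neutral)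
  qed
  then show ?thesis by simp
qed

lemma red_InL_star: "red_o\<^sup>*\<^sup>* (InL A D) X \<Longrightarrow> \<exists>A' D'. X = InL A' D' \<and> red_o\<^sup>*\<^sup>* D D'"
  by (induction rule: rtranclp_induct) (auto elim!: red_InLE intro: rtranclp.rtrancl_into_rtrancl)

lemma red_InR_star: "red_o\<^sup>*\<^sup>* (InR A D) X \<Longrightarrow> \<exists>A' D'. X = InR A' D' \<and> red_o\<^sup>*\<^sup>* D D'"
  by (induction rule: rtranclp_induct) (auto elim!: red_InRE intro: rtranclp.rtrancl_into_rtrancl)

lemma RED_red_star: "red_o\<^sup>*\<^sup>* D D' \<Longrightarrow> D \<in> RED t \<Longrightarrow> D' \<in> RED t"
  by (induction rule: rtranclp_induct) (auto intro: RED_red)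

lemma RED_InL:
  assumes "sn red_f A" "D \<in> RED s"
  shows "InL A D \<in> RED (SSum s t)"
proof -
  have "sn red_o (InL A D)"
    by (rule sn_map2[OF assms(1) RED_sn[OF assms(2)]]) (auto elim: red_InLE)
  then show ?thesis using assms(2) by (auto dest!: red_InL_star intro: RED_red_star)
qed

lemma RED_InR:
  assumes "sn red_f A" "D \<in> RED t"
  shows "InR A D \<in> RED (SSum s t)"
proof -
  have "sn red_o (InR A D)"
    by (rule sn_map2[OF assms(1) RED_sn[OF assms(2)]]) (auto elim: red_InRE)
  then show ?thesis using assms(2) by (auto dest!: red_InR_star intro: RED_red_star)
qed

lemma RED_SSum_D:
  "InL A D \<in> RED (SSum s t) \<Longrightarrow> D \<in> RED s" "InR A D \<in> RED (SSum s t) \<Longrightarrow> D \<in> RED t"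
  by simp_all blast+

text \<open>The branches step only together, so the inductions are on the first branch and on the
  argument. If the argument is an injection, its content is reducible by the sum clause with zero
  steps.\<close>

lemma RED_CoPair:
  assumes "D \<in> RED (SArr s u)" "E \<in> RED (SArr t u)"
  shows "CoPair D E \<in> RED (SArr (SSum s t) u)"
proof -
  have "App (CoPair D E) F \<in> RED u" if "F \<in> RED (SSum s t)" for F
    using RED_sn[OF assms(1)] RED_sn[OF that] assms that
  proof (induction arbitrary: E F rule: sn_induct)
    case (step D)
    note D = step.IH
    from step.prems show ?case
    proof (induction F rule: sn_induct)
      case (step F)
      show ?case
      proof (rule RED_neutral)
        fix X assume X: "red_o (App (CoPair D E) F) X"
        then consider
            (inl) A F' where "F = InL A F'" "X = App D F'"
          | (inr) A F' where "F = InR A F'" "X = App E F'"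
          | (copair) D' E' where "X = App (CoPair D' E') F" "red_o D D'" "red_o E E'"
          | (arg) F' where "X = App (CoPair D E) F'" "red_o F F'"
          by (auto elim!: red_AppE red_CoPairE)
        then show "X \<in> RED u"
        proof cases
          case inl
          then show ?thesis using step.prems by (auto dest: RED_SSum_D simp del: RED.simps(5))
        next
          case inr
          then show ?thesis using step.prems by (auto dest: RED_SSum_D simp del: RED.simps(5))
        next
          case copair
          then show ?thesis using D RED_red step.prems step.hyps by blast
        next
          case arg
          then show ?thesis using step RED_red by blast
        qed
      qed simp
    qed
  qed
  then show ?thesis by simp
qed

section \<open>Soundness of typing for reducibility\<close>

definition good :: "ctx \<Rightarrow> (nat \<Rightarrow> obj) \<Rightarrow> bool" where
  "good G s \<longleftrightarrow> (\<forall>i < length G. s i \<in> RED (erase (G ! i)))"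

text \<open>The rules for binders have no premise on the family \<open>A\<close> of the bound
  variable; its normalization comes only from the extended context and is therefore carried through
  the induction.\<close>

primrec sn_ctx :: "ctx \<Rightarrow> bool" where
  "sn_ctx [] = True"
| "sn_ctx (A # G) = (sn_ctx G \<and> (\<forall>s. good G s \<longrightarrow> sn red_f (psubst_f A s)))"

lemma good_Cons: "E \<in> RED (erase A) \<Longrightarrow> good G s \<Longrightarrow> good (A # G) (case_nat E s)"
  by (auto simp: good_def less_Suc_eq_0_disj)

lemma good_Var: "good G Var"
  by (simp add: good_def RED_Var)

text \<open>Instantiating the bound variable with the reducible \<open>Var 0\<close> gives a
  substitution that is good for the extended context; normalization then reflects back.\<close>

lemma sn_under_binder:
  assumes "good G s"
  shows "(\<forall>s. good (A # G) s \<longrightarrow> sn red_f (psubst_f B s)) \<Longrightarrow> sn red_f (psubst_f B (ups s))"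
    and "(\<forall>s. good (A # G) s \<longrightarrow> sn red_k (psubst_k K s)) \<Longrightarrow> sn red_k (psubst_k K (ups s))"
  by (rule sn_subst(1,3)[where S = "Var 0" and k = 0],
      simp add: subst_psubst_ups good_Cons[OF RED_Var assms])+

lemma typing_sound:
  "is_sig S \<Longrightarrow> True"
  "is_ctx S G \<Longrightarrow> sn_ctx G"
  "is_kind S G K \<Longrightarrow> sn_ctx G \<and> (\<forall>s. good G s \<longrightarrow> sn red_k (psubst_k K s))"
  "has_kind S G A K \<Longrightarrow> sn_ctx G \<and> (\<forall>s. good G s \<longrightarrow> sn red_f (psubst_f A s))"
  "has_type S G D A \<Longrightarrow> sn_ctx G \<and> (\<forall>s. good G s \<longrightarrow> psubst_o D s \<in> RED (erase A))"
proof (induction rule: is_sig_is_ctx_is_kind_has_kind_has_type.inducts)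
  case (k_type S G)
  have "sn red_k KType" by (rule snI) (auto elim: red_kE)
  then show ?case using k_type by simp
next
  case (k_pi S A G K)
  show ?case
  proof (intro conjI allI impI)
    fix s assume "good G s"
    then have "sn red_f (psubst_f A s)" "sn red_k (psubst_k K (ups s))"
      using k_pi.IH sn_under_binder(2) by auto
    then show "sn red_k (psubst_k (KPi A K) s)"
      by simp (erule (1) sn_map2, auto elim: red_kE)
  qed (use k_pi in simp)
next
  case (f_const S G a K)
  have "sn red_f (FConst a)" by (rule snI) (auto elim: red_fE)
  then show ?case using f_const by simp
next
  case (f_pi S A G B)
  show ?case
  proof (intro conjI allI impI)
    fix s assume "good G s"
    then have "sn red_f (psubst_f A s)" "sn red_f (psubst_f B (ups s))"
      using f_pi.IH sn_under_binder(1) by auto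
    then show "sn red_f (psubst_f (FPi A B) s)"
      by simp (erule (1) sn_map2, auto elim: red_fE)
  qed (use f_pi in simp)
next
  case (f_app S G A B K D)
  show ?case
  proof (intro conjI allI impI)
    fix s assume "good G s"
    then have "sn red_f (psubst_f A s)" "sn red_o (psubst_o D s)"
      using f_app.IH RED_sn by auto
    then show "sn red_f (psubst_f (FApp A D) s)"
      by simp (erule (1) sn_map2, auto elim: red_fE)
  qed (use f_app in simp)
next
  case (f_rarr S G A B)
  then show ?case by (auto intro!: sn_map2[where f = RArr] elim: red_fE)
next
  case (f_inter S G A B)
  then show ?case by (auto intro!: sn_map2[where f = FInter] elim: red_fE)
next
  case (f_union S G A B)
  then show ?case by (auto intro!: sn_map2[where f = FUnion] elim: red_fE)
next
  case (o_const S G c A)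
  then show ?case by (simp add: RED_Const)
next
  case (o_var S G i)
  then show ?case by (simp add: good_def erase_lookup)
next
  case (o_lam S A G D B)
  then show ?case
    by (auto intro!: RED_Lam simp: subst_psubst_ups good_Cons simp del: RED.simps)
next
  case (o_rlam S A G D B)
  then show ?case
    by (auto intro!: RED_RLam simp: subst_psubst_ups good_Cons simp del: RED.simps)
next
  case (o_pair S G D A E B)
  then show ?case by (auto intro!: RED_SPair simp del: RED.simps)
next
  case (o_inl S G D A B)
  \<comment> \<open>The annotation is known only as a component of the union, into which its steps
    embed.\<close>
  have "sn red_f (psubst_f B s)" if "good G s" for s
    by (rule sn_reflect[where g = "FUnion (psubst_f A s)" and R' = red_f])
      (use that o_inl.IH in \<open>auto intro: red_f_red_o.intros\<close>)
  then show ?case using o_inl.IH by (auto intro!: RED_InL simp del: RED.simps)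
next
  case (o_inr S G D B A)
  have "sn red_f (psubst_f A s)" if "good G s" for s
    by (rule sn_reflect[where g = "\<lambda>A. FUnion A (psubst_f B s)" and R' = red_f])
      (use that o_inr.IH in \<open>auto intro: red_f_red_o.intros\<close>)
  then show ?case using o_inr.IH by (auto intro!: RED_InR simp del: RED.simps)
next
  \<comment> \<open>Erasure forgets the injections substituted into \<open>C\<close>, so both
    branches have the same erased codomain.\<close>
  case (o_copair S G D A C B E)
  then show ?case by (auto intro!: RED_CoPair simp del: RED.simps)
next
  case (o_conv S G D A B)
  then show ?case by (simp add: erase_conv)
qed simp_all

lemma typing_sn:
  "is_kind S G K \<Longrightarrow> sn red_k K"
  "has_kind S G A K \<Longrightarrow> sn red_f A"
  "has_type S G D A \<Longrightarrow> sn red_o D"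
  using typing_sound(3-5)[THEN conjunct2, THEN spec, THEN mp, OF _ good_Var] RED_sn
  by (simp_all, blast)

section \<open>Strict intersection types for strongly normalizing terms\<close>

text \<open>The list in \<open>IArr\<close> stands for an intersection. Types of variables and constants are
  given by two functions into lists, a list being again read as an intersection.\<close>

datatype ity = IBase | IArr "ity list" ity

inductive ityp :: "(nat \<Rightarrow> ity list) \<Rightarrow> (nat \<Rightarrow> ity list) \<Rightarrow> lterm \<Rightarrow> ity \<Rightarrow> bool" for C where
  ityp_var: "t \<in> set (e i) \<Longrightarrow> ityp C e (LVar i) t"
| ityp_const: "t \<in> set (C c) \<Longrightarrow> ityp C e (LConst c) t"
| ityp_abs: "ityp C (case_nat L e) M t \<Longrightarrow> L \<noteq> [] \<Longrightarrow> ityp C e (LAbs M) (IArr L t)"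
| ityp_app: "ityp C e M (IArr L t) \<Longrightarrow> L \<noteq> [] \<Longrightarrow> (\<And>s. s \<in> set L \<Longrightarrow> ityp C e N s) \<Longrightarrow>
     ityp C e (LApp M N) t"

inductive_cases ityp_varE: "ityp C e (LVar i) t"
inductive_cases ityp_constE: "ityp C e (LConst i) t"
inductive_cases ityp_absE: "ityp C e (LAbs M) t"
inductive_cases ityp_appE: "ityp C e (LApp M N) t"

section \<open>Monotonicity and expansion of a substitution\<close>

lemma ityp_mono:
  assumes "ityp C e M t" "\<And>i. set (e i) \<subseteq> set (e' i)" "\<And>c. set (C c) \<subseteq> set (C' c)"
  shows "ityp C' e' M t"
  using assms(1,2)
proof (induction arbitrary: e')
  case (ityp_var t e i)
  then show ?case by (blast intro: ityp.ityp_var)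
next
  case (ityp_const t c e)
  then show ?case using assms(3) by (blast intro: ityp.ityp_const)
next
  case (ityp_abs L e M t)
  have "ityp C' (case_nat L e') M t"
    by (rule ityp_abs.IH) (use ityp_abs.prems in \<open>auto split: nat.splits\<close>)
  then show ?case using ityp_abs.hyps by (auto intro: ityp.intros)
next
  case (ityp_app e M L t N)
  then show ?case by (auto intro!: ityp.ityp_app[of _ _ _ L])
qed

text \<open>The environments that match \<open>lift_l\<close> and \<open>subst_l\<close> at depth
  \<open>k\<close>, below binders.\<close>

definition ins :: "nat \<Rightarrow> 'a \<Rightarrow> (nat \<Rightarrow> 'a) \<Rightarrow> nat \<Rightarrow> 'a" where
  "ins k x e i = (if i < k then e i else if i = k then x else e (i - 1))"

lemma case_nat_ins: "case_nat y (ins k x e) = ins (Suc k) x (case_nat y e)"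
  by (rule ext) (auto simp: ins_def split: nat.split)

lemma ins_0: "ins 0 x e = case_nat x e"
  by (rule ext) (auto simp: ins_def split: nat.split)

text \<open>Index \<open>k\<close> is not free in the lifted term, so its entry is never read.
  Typings of an argument found under a binder are brought outside in this way.\<close>

lemma ityp_lift_strengthen: "ityp C (ins k L e) (lift_l N k) t \<Longrightarrow> ityp C e N t"
proof (induction N arbitrary: k e t)
  case (LVar i)
  then show ?case by (auto simp: ins_def intro: ityp.intros elim!: ityp_varE split: if_splits)
next
  case (LConst c)
  then show ?case by (auto intro: ityp.intros elim!: ityp_constE)
next
  case (LAbs N)
  then show ?case by (auto simp: case_nat_ins intro: ityp.intros elim!: ityp_absE)
next
  case (LApp N1 N2)
  from LApp.prems obtain L' where "ityp C (ins k L e) (lift_l N1 k) (IArr L' t)" "L' \<noteq> []"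
    "\<And>s. s \<in> set L' \<Longrightarrow> ityp C (ins k L e) (lift_l N2 k) s"
    by (auto elim!: ityp_appE)
  then show ?case using LApp.IH by (blast intro: ityp.ityp_app)
qed

lemma ityp_ins_mono:
  "ityp C (ins k L e) M t \<Longrightarrow> set L \<subseteq> set L' \<Longrightarrow> ityp C (ins k L' e) M t"
  by (erule ityp_mono) (auto simp: ins_def)

lemma ityp_lift_weaken: "ityp C e N t \<Longrightarrow> ityp C (ins k L e) (lift_l N k) t"
proof (induction arbitrary: k rule: ityp.induct)
  case (ityp_app e M L t N)
  then show ?case by (auto intro!: ityp.ityp_app)
qed (auto simp: ins_def case_nat_ins intro!: ityp.intros)

text \<open>The list \<open>L\<close> collects the types at which the copies of \<open>N\<close> are
  used. If there is no copy, the given type \<open>s\<close> keeps the list nonempty.\<close>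

lemma ityp_subst_expansion:
  assumes "ityp C e (subst_l M N k) t" "ityp C e N s"
  shows "\<exists>L. L \<noteq> [] \<and> ityp C (ins k L e) M t \<and> (\<forall>u \<in> set L. ityp C e N u)"
  using assms
proof (induction M arbitrary: N k e t s)
  case (LVar i)
  consider "i = k" | "i \<noteq> k" by blast
  then show ?case
  proof cases
    case 1
    then show ?thesis using LVar
      by (intro exI[of _ "[t]"]) (auto simp: ins_def intro: ityp.intros)
  next
    case 2
    then show ?thesis using LVar
      by (intro exI[of _ "[s]"])
        (auto simp: ins_def intro!: ityp.intros elim!: ityp_varE split: if_splits)
  qed
next
  case (LConst c)
  then show ?case
    by (intro exI[of _ "[s]"]) (auto intro: ityp.intros elim!: ityp_constE)
next
  case (LAbs M)
  from LAbs.prems(1) obtain L' t' where t: "t = IArr L' t'" "L' \<noteq> []"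
    and M: "ityp C (case_nat L' e) (subst_l M (lift_l N 0) (Suc k)) t'"
    by (auto elim!: ityp_absE)
  obtain L where "L \<noteq> []" "ityp C (ins (Suc k) L (case_nat L' e)) M t'"
    "\<forall>u \<in> set L. ityp C (case_nat L' e) (lift_l N 0) u"
    using LAbs.IH[OF M ityp_lift_weaken[OF LAbs.prems(2), of 0 L', unfolded ins_0]] by blast
  then show ?case
    using t by (auto simp: case_nat_ins intro!: exI[of _ L] ityp.intros
        dest: ityp_lift_strengthen[of C 0 L', unfolded ins_0])
next
  case (LApp M1 M2)
  from LApp.prems(1) obtain L where L: "L \<noteq> []" "ityp C e (subst_l M1 N k) (IArr L t)"
    "\<forall>u \<in> set L. ityp C e (subst_l M2 N k) u"
    by (auto elim!: ityp_appE)
  obtain L1 where L1: "L1 \<noteq> []" "ityp C (ins k L1 e) M1 (IArr L t)" "\<forall>u \<in> set L1. ityp C e N u"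
    using LApp.IH(1)[OF L(2) LApp.prems(2)] by blast
  \<comment> \<open>Each type required of \<open>M2\<close> may use \<open>N\<close> at other types:
    one list per type is chosen, and all are joined with the list for \<open>M1\<close>.\<close>
  have "\<forall>u \<in> set L. \<exists>L2. ityp C (ins k L2 e) M2 u \<and> (\<forall>v \<in> set L2. ityp C e N v)"
    using LApp.IH(2) L(3) LApp.prems(2) by blast
  then obtain f where f: "\<And>u. u \<in> set L \<Longrightarrow> ityp C (ins k (f u) e) M2 u"
    "\<And>u v. u \<in> set L \<Longrightarrow> v \<in> set (f u) \<Longrightarrow> ityp C e N v"
    by metis
  let ?L = "L1 @ concat (map f L)"
  have "ityp C (ins k ?L e) M1 (IArr L t)"
    by (rule ityp_ins_mono[OF L1(2)]) auto
  moreover have "ityp C (ins k ?L e) M2 u" if "u \<in> set L" for u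
    by (rule ityp_ins_mono[OF f(1)[OF that]]) (use that in auto)
  ultimately have "ityp C (ins k ?L e) (LApp M1 M2) t"
    using L(1) by (auto intro: ityp.ityp_app)
  then show ?case using L1 f by (intro exI[of _ ?L]) auto
qed

section \<open>Typability by head expansion\<close>

definition typable :: "lterm \<Rightarrow> bool" where
  "typable M \<longleftrightarrow> (\<exists>C e t. ityp C e M t)"

fun subterms :: "lterm \<Rightarrow> lterm set" where
  "subterms (LVar i) = {LVar i}"
| "subterms (LConst c) = {LConst c}"
| "subterms (LAbs M) = insert (LAbs M) (subterms M)"
| "subterms (LApp M N) = insert (LApp M N) (subterms M \<union> subterms N)"

lemma subterms_refl [simp]: "M \<in> subterms M"
  by (cases M) auto

lemma subterms_trans: "M \<in> subterms N \<Longrightarrow> N \<in> subterms P \<Longrightarrow> M \<in> subterms P"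
  by (induction P) auto

text \<open>Makes an induction hypothesis on the reducts of a term available for the reducts of its
  subterms.\<close>

lemma beta_subterm:
  "N \<in> subterms M \<Longrightarrow> beta N N' \<Longrightarrow> \<exists>M'. beta M M' \<and> N' \<in> subterms M'"
proof (induction M)
  case (LVar i)
  then show ?case using subterms_refl by auto
next
  case (LConst c)
  then show ?case using subterms_refl by auto
next
  case (LAbs M)
  consider "N = LAbs M" | "N \<in> subterms M"
    using LAbs.prems by auto
  then show ?case
  proof cases
    case 1
    then show ?thesis using LAbs.prems subterms_refl by blast
  next
    case 2
    then obtain M' where "beta M M'" "N' \<in> subterms M'" using LAbs by blast
    then show ?thesis by (intro exI[of _ "LAbs M'"]) (auto intro: beta.intros)
  qed
next
  case (LApp M1 M2)
  consider "N = LApp M1 M2" | "N \<in> subterms M1" | "N \<in> subterms M2"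
    using LApp.prems by auto
  then show ?case
  proof cases
    case 1
    then show ?thesis using LApp.prems subterms_refl by blast
  next
    case 2
    then obtain M' where "beta M1 M'" "N' \<in> subterms M'" using LApp by blast
    then show ?thesis by (intro exI[of _ "LApp M' M2"]) (auto intro: beta.intros)
  next
    case 3
    then obtain M' where "beta M2 M'" "N' \<in> subterms M'" using LApp by blast
    then show ?thesis by (intro exI[of _ "LApp M1 M'"]) (auto intro: beta.intros)
  qed
qed

text \<open>Weak head reduction, with no rule under abstractions: an abstraction is typed from its
  body.\<close>

inductive head_beta :: "lterm \<Rightarrow> lterm \<Rightarrow> bool" where
  "head_beta (LApp (LAbs M) N) (subst_l M N 0)"
| "head_beta M M' \<Longrightarrow> head_beta (LApp M N) (LApp M' N)"

lemma head_beta_imp_beta: "head_beta M M' \<Longrightarrow> beta M M'"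
  by (induction rule: head_beta.induct) (auto intro: beta.intros)

fun atom_headed :: "lterm \<Rightarrow> bool" where
  "atom_headed (LVar i) = True"
| "atom_headed (LConst c) = True"
| "atom_headed (LAbs M) = False"
| "atom_headed (LApp M N) = atom_headed M"

lemma head_cases: "(\<exists>N. M = LAbs N) \<or> atom_headed M \<or> (\<exists>M'. head_beta M M')"
  by (induction M) (auto intro: head_beta.intros)

lemma ityp_union:
  assumes "ityp C e M t"
  shows "ityp (\<lambda>c. C c @ C' c) (\<lambda>i. e i @ e' i) M t" "ityp (\<lambda>c. C' c @ C c) (\<lambda>i. e' i @ e i) M t"
  by (rule ityp_mono[OF assms]; simp)+

text \<open>The type of the head is free and is chosen as an arrow accepting the arguments. The
  result \<open>t\<close> is arbitrary so that the induction can ask \<open>M\<close> for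
  \<open>IArr [s] t\<close>.\<close>

lemma atom_headed_typable:
  assumes "atom_headed M" and "\<And>P N. LApp P N \<in> subterms M \<Longrightarrow> typable N"
  shows "\<exists>C e. ityp C e M t"
  using assms
proof (induction M arbitrary: t rule: atom_headed.induct)
  case (1 i)
  show ?case by (rule exI[of _ "\<lambda>_. []"], rule exI[of _ "\<lambda>_. [t]"]) (simp add: ityp_var)
next
  case (2 c)
  show ?case by (rule exI[of _ "\<lambda>_. [t]"], rule exI[of _ "\<lambda>_. []"]) (simp add: ityp_const)
next
  case (4 M N)
  obtain C e s where N: "ityp C e N s"
    using 4(3)[of M N] by (auto simp: typable_def)
  obtain C' e' where M: "ityp C' e' M (IArr [s] t)"
    using 4(1)[of "IArr [s] t"] 4(2,3) by auto
  have "ityp (\<lambda>c. C c @ C' c) (\<lambda>i. e i @ e' i) (LApp M N) t"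
    by (rule ityp_app[OF ityp_union(2)[OF M]]) (auto intro: ityp_union(1)[OF N])
  then show ?case by blast
qed simp

text \<open>The contracted redex may discard its argument, which then brings an environment of its
  own. Environments only grow, so that arguments further out on the spine keep their types.\<close>

lemma head_expansion:
  assumes "head_beta M M'" "ityp C e M' t" and "\<And>P N. LApp P N \<in> subterms M \<Longrightarrow> typable N"
  shows "\<exists>C' e'. (\<forall>c. set (C c) \<subseteq> set (C' c)) \<and> (\<forall>i. set (e i) \<subseteq> set (e' i)) \<and> ityp C' e' M t"
  using assms
proof (induction arbitrary: t rule: head_beta.induct)
  case (1 M N)
  obtain C1 e1 s where N: "ityp C1 e1 N s"
    using 1(2)[of "LAbs M" N] by (auto simp: typable_def)
  let ?C = "\<lambda>c. C c @ C1 c" and ?e = "\<lambda>i. e i @ e1 i"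
  obtain L where "L \<noteq> []" "ityp ?C (ins 0 L ?e) M t" "\<forall>u \<in> set L. ityp ?C ?e N u"
    using ityp_subst_expansion[OF ityp_union(1)[OF 1(1)] ityp_union(2)[OF N]] by blast
  then have "ityp ?C ?e (LApp (LAbs M) N) t"
    by (auto simp: ins_0 intro: ityp.intros)
  then show ?case by (intro exI[of _ ?C] exI[of _ ?e]) auto
next
  case (2 M M' N)
  from 2(3) obtain L where L: "ityp C e M' (IArr L t)" "L \<noteq> []" "\<And>s. s \<in> set L \<Longrightarrow> ityp C e N s"
    by (auto elim!: ityp_appE)
  obtain C' e' where *: "\<And>c. set (C c) \<subseteq> set (C' c)" "\<And>i. set (e i) \<subseteq> set (e' i)"
    "ityp C' e' M (IArr L t)"
    using 2(2)[OF L(1)] 2(4) by (metis UnI1 insertI2 subterms.simps(4))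
  have "ityp C' e' (LApp M N) t"
    using ityp_mono[OF L(3) *(2,1)] by (auto intro!: ityp.ityp_app[OF *(3) L(2)])
  then show ?case using * by blast
qed

text \<open>Outer induction on the reducts of \<open>M\<close>, inner induction on the size of
  \<open>N\<close>. Both atom-headed terms and head expansion ask for typed arguments, hence the
  claim for all subterms.\<close>

lemma sn_subterms_typable: "sn beta M \<Longrightarrow> N \<in> subterms M \<Longrightarrow> typable N"
proof (induction arbitrary: N rule: sn_induct)
  case (step M)
  note reducts = step.IH
  from step.prems show ?case
  proof (induction "size N" arbitrary: N rule: less_induct)
    case less
    have sub: "typable P" if "P \<in> subterms N" "size P < size N" for P
      using less that subterms_trans by blast
    have size: "size P \<le> size N" if "P \<in> subterms N" for P N
      using that by (induction N) auto
    have arg: "typable Q" if "LApp P Q \<in> subterms N" for P Q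
      using sub[of Q] subterms_trans[of Q "LApp P Q" N] size[OF that] that by auto
    consider (abs) P where "N = LAbs P" | (atom) "atom_headed N" | (head) N' where "head_beta N N'"
      using head_cases by blast
    then show ?case
    proof cases
      case abs
      then obtain C e t where P: "ityp C e P t"
        using sub[of P] by (auto simp: typable_def)
      \<comment> \<open>Adding \<open>IBase\<close> makes the list of the bound variable nonempty
        even if the variable does not occur.\<close>
      have "ityp C (case_nat (IBase # e 0) (\<lambda>i. e (Suc i))) P t"
        by (rule ityp_mono[OF P]) (auto split: nat.split)
      then show ?thesis
        using abs unfolding typable_def by (blast intro: ityp.intros)
    next
      case atom
      have "\<exists>C e. ityp C e N IBase"
        by (rule atom_headed_typable[OF atom]) (rule arg)
      then show ?thesis unfolding typable_def by blast
    next
      case head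
      \<comment> \<open>Here \<open>N'\<close> is a subterm of a reduct of \<open>M\<close>, so the
        outer hypothesis applies.\<close>
      have "typable N'"
        using reducts beta_subterm[OF less.prems head_beta_imp_beta[OF head]] by blast
      then obtain C e t where "ityp C e N' t" by (auto simp: typable_def)
      then have "\<exists>C' e'. (\<forall>c. set (C c) \<subseteq> set (C' c)) \<and> (\<forall>i. set (e i) \<subseteq> set (e' i)) \<and>
          ityp C' e' N t"
        by (rule head_expansion[OF head]) (rule arg)
      then show ?thesis unfolding typable_def by blast
    qed
  qed
qed

section \<open>From intersection derivations to annotated terms\<close>

text \<open>The value at the empty list is irrelevant: the lists on the left of \<open>IArr\<close> are
  nonempty in derivations, and a variable with an empty list is never typed.\<close>

fun inter :: "fam list \<Rightarrow> fam" where
  "inter [] = FConst 0"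
| "inter [A] = A"
| "inter (A # As) = FInter A (inter As)"

primrec fam_of :: "ity \<Rightarrow> fam" where
  "fam_of IBase = FConst 0"
| "fam_of (IArr L t) = FPi (inter (map fam_of L)) (fam_of t)"

abbreviation fam_of_list :: "ity list \<Rightarrow> fam" where
  "fam_of_list L \<equiv> inter (map fam_of L)"

lemma inter_closed:
  "(\<And>A. A \<in> set As \<Longrightarrow> lift_f A k = A) \<Longrightarrow> lift_f (inter As) k = inter As"
  "(\<And>A. A \<in> set As \<Longrightarrow> subst_f A E k = A) \<Longrightarrow> subst_f (inter As) E k = inter As"
  "(\<And>A. A \<in> set As \<Longrightarrow> coherent_f A) \<Longrightarrow> coherent_f (inter As)"
  by (induction As rule: inter.induct) simp_all

text \<open>No objects occur in these families, so \<open>FPi\<close> acts as a plain arrow on them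
  and types from the context need no weakening.\<close>

lemma fam_of_closed [simp]:
  "lift_f (fam_of t) k = fam_of t" "subst_f (fam_of t) E k = fam_of t" "coherent_f (fam_of t)"
  by (induction t arbitrary: k E) (auto intro!: inter_closed)

lemma fam_of_list_closed [simp]:
  "lift_f (fam_of_list L) k = fam_of_list L" "coherent_f (fam_of_list L)"
  by (auto intro!: inter_closed)

lemma has_kind_inter:
  "FDecl 0 KType \<in> set S \<Longrightarrow> is_ctx S G \<Longrightarrow> (\<And>A. A \<in> set As \<Longrightarrow> has_kind S G A KType) \<Longrightarrow>
    has_kind S G (inter As) KType"
  by (induction As rule: inter.induct) (auto intro: f_const f_inter)

lemma has_kind_fam_of:
  "FDecl 0 KType \<in> set S \<Longrightarrow> is_ctx S G \<Longrightarrow> has_kind S G (fam_of t) KType"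
proof (induction t arbitrary: G)
  case IBase
  then show ?case by (auto intro: f_const)
next
  case (IArr L t)
  have "has_kind S G (fam_of_list L) KType"
    by (rule has_kind_inter) (use IArr in auto)
  then have "is_ctx S (fam_of_list L # G)" using IArr by (auto intro: ctx_ext)
  then show ?case using IArr by (auto intro: f_pi)
qed

lemma has_kind_fam_of_list:
  "FDecl 0 KType \<in> set S \<Longrightarrow> is_ctx S G \<Longrightarrow> has_kind S G (fam_of_list L) KType"
  by (rule has_kind_inter) (auto intro: has_kind_fam_of)

definition annotates :: "sig \<Rightarrow> ctx \<Rightarrow> lterm \<Rightarrow> fam \<Rightarrow> bool" where
  "annotates S G M A \<longleftrightarrow> (\<exists>D. has_type S G D A \<and> coherent_o D \<and> essence D = M)"

lemma annotates_project:
  "annotates S G M (inter As) \<Longrightarrow> A \<in> set As \<Longrightarrow> annotates S G M A"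
proof (induction As rule: inter.induct)
  case (3 B A' As)
  then obtain D where D: "has_type S G D (FInter B (inter (A' # As)))" "coherent_o D" "essence D = M"
    by (auto simp: annotates_def)
  have "annotates S G M B"
    unfolding annotates_def by (rule exI[of _ "PrL D"]) (use D in \<open>auto intro: o_prl\<close>)
  moreover have "annotates S G M (inter (A' # As))"
    unfolding annotates_def by (rule exI[of _ "PrR D"]) (use D in \<open>auto intro: o_prr\<close>)
  ultimately show ?case using 3 by auto
qed auto

text \<open>All annotations have exactly the essence \<open>M\<close>, so pairing them is coherent
  and the eta premise holds by reflexivity.\<close>

lemma annotates_inter:
  "As \<noteq> [] \<Longrightarrow> (\<And>A. A \<in> set As \<Longrightarrow> annotates S G M A) \<Longrightarrow> annotates S G M (inter As)"
proof (induction As rule: inter.induct)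
  case (3 B A' As)
  then have "annotates S G M B" "annotates S G M (inter (A' # As))" by auto
  then obtain D E where "has_type S G D B" "has_type S G E (inter (A' # As))"
    "coherent_o D" "coherent_o E" "essence D = M" "essence E = M"
    by (auto simp: annotates_def)
  then show ?case
    unfolding annotates_def by (intro exI[of _ "SPair D E"]) (auto intro: o_pair)
qed auto

section \<open>Finite signatures and contexts for a given term\<close>

text \<open>Type environments are total functions, while contexts and signatures are finite lists;
  \<open>n\<close> and \<open>m\<close> cut off the relevant parts of \<open>e\<close> and
  \<open>C\<close>.\<close>

primrec below :: "lterm \<Rightarrow> nat \<Rightarrow> nat \<Rightarrow> bool" where
  "below (LVar i) n m \<longleftrightarrow> i < n"
| "below (LConst c) n m \<longleftrightarrow> c < m"
| "below (LAbs M) n m \<longleftrightarrow> below M (Suc n) m"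
| "below (LApp M N) n m \<longleftrightarrow> below M n m \<and> below N n m"

lemma below_mono: "below M n m \<Longrightarrow> n \<le> n' \<Longrightarrow> m \<le> m' \<Longrightarrow> below M n' m'"
  by (induction M arbitrary: n n') auto

lemma below_exists: "\<exists>n m. below M n m"
proof (induction M)
  case (LAbs M)
  then show ?case by (auto intro: below_mono[OF _ le_SucI[OF order_refl] order_refl])
next
  case (LApp M N)
  then obtain n m n' m' where "below M n m" "below N n' m'" by blast
  then have "below (LApp M N) (max n n') (max m m')" by (auto intro: below_mono)
  then show ?case by blast
qed auto

lemma lookup_closed: "lift_f (G ! i) 0 = G ! i \<Longrightarrow> lookup G i = G ! i"
proof -
  assume *: "lift_f (G ! i) 0 = G ! i"
  have "((\<lambda>A. lift_f A 0) ^^ n) (G ! i) = G ! i" for n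
    by (induction n) (simp_all add: *)
  then show ?thesis by (simp only: lookup_def)
qed

lemma annotates_ityp:
  assumes "ityp C e M t" "below M (length G) m" "is_ctx S G" "FDecl 0 KType \<in> set S"
    and "\<And>c. c < m \<Longrightarrow> ODecl c (fam_of_list (C c)) \<in> set S"
    and "\<And>i. i < length G \<Longrightarrow> G ! i = fam_of_list (e i)"
  shows "annotates S G M (fam_of t)"
  using assms(1-3,6)
proof (induction arbitrary: G)
  case (ityp_var t e i)
  have "has_type S G (Var i) (fam_of_list (e i))"
    using o_var[OF ityp_var(3), of i] ityp_var lookup_closed[of G i] by simp
  then have "annotates S G (LVar i) (fam_of_list (e i))"
    unfolding annotates_def by (intro exI[of _ "Var i"]) simp
  then show ?case using ityp_var(1) by (auto intro: annotates_project)
next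
  case (ityp_const t c e)
  have "has_type S G (Const c) (fam_of_list (C c))"
    using ityp_const assms(5) by (auto intro: o_const)
  then have "annotates S G (LConst c) (fam_of_list (C c))"
    unfolding annotates_def by (intro exI[of _ "Const c"]) simp
  then show ?case using ityp_const(1) by (auto intro: annotates_project)
next
  case (ityp_abs L e M t)
  have "annotates S (fam_of_list L # G) M (fam_of t)"
  proof (rule ityp_abs.IH)
    show "is_ctx S (fam_of_list L # G)"
      using ityp_abs assms(4) by (auto intro: ctx_ext has_kind_fam_of_list)
  qed (use ityp_abs in \<open>auto simp: less_Suc_eq_0_disj\<close>)
  then obtain D where "has_type S (fam_of_list L # G) D (fam_of t)" "coherent_o D" "essence D = M"
    by (auto simp: annotates_def)
  then show ?case
    unfolding annotates_def
    by (intro exI[of _ "Lam (fam_of_list L) D"]) (auto intro: o_lam)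
next
  case (ityp_app e M L t N)
  have "annotates S G M (FPi (fam_of_list L) (fam_of t))"
    using ityp_app by simp
  moreover have "annotates S G N (fam_of_list L)"
    by (rule annotates_inter) (use ityp_app in auto)
  ultimately obtain D E where D: "has_type S G D (FPi (fam_of_list L) (fam_of t))"
    "coherent_o D" "essence D = M" and E: "has_type S G E (fam_of_list L)" "coherent_o E" "essence E = N"
    by (auto simp: annotates_def)
  then show ?case
    unfolding annotates_def
    using o_app[OF D(1) E(1)] by (intro exI[of _ "App D E"]) auto
qed

text \<open>The only family constant stands at the bottom because the types of all object constants
  are built from it.\<close>

fun sig_of :: "(nat \<Rightarrow> ity list) \<Rightarrow> nat \<Rightarrow> sig" where
  "sig_of C 0 = [FDecl 0 KType]"
| "sig_of C (Suc m) = ODecl m (fam_of_list (C m)) # sig_of C m"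

lemma FDecl_sig_of: "FDecl a K \<in> set (sig_of C m) \<longleftrightarrow> a = 0 \<and> K = KType"
  by (induction m) auto

lemma ODecl_sig_of: "ODecl c A \<in> set (sig_of C m) \<longleftrightarrow> c < m \<and> A = fam_of_list (C c)"
  by (induction m) (auto simp: less_Suc_eq)

lemma is_sig_sig_of: "is_sig (sig_of C m)"
proof (induction m)
  case 0
  show ?case by (auto simp: fdom_def intro!: sig_fam sig_empty k_type ctx_empty)
next
  case (Suc m)
  then show ?case
    by (auto simp: odom_def ODecl_sig_of FDecl_sig_of intro!: sig_obj has_kind_fam_of_list ctx_empty)
qed

lemma is_ctx_fam_of_list:
  "is_sig S \<Longrightarrow> FDecl 0 KType \<in> set S \<Longrightarrow> is_ctx S (map (\<lambda>i. fam_of_list (e i)) xs)"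
  by (induction xs) (auto intro: ctx_empty ctx_ext has_kind_fam_of_list)

lemma sn_essence:
  assumes "sn beta M"
  shows "\<exists>S G D A. coherent_sig S \<and> coherent_ctx G \<and> coherent_o D \<and> coherent_f A \<and>
    has_type S G D A \<and> essence D = M"
proof -
  obtain C e t where t: "ityp C e M t"
    using sn_subterms_typable[OF assms subterms_refl] by (auto simp: typable_def)
  obtain n m where nm: "below M n m" using below_exists by blast
  let ?S = "sig_of C m" and ?G = "map (\<lambda>i. fam_of_list (e i)) [0..<n]"
  have "annotates ?S ?G M (fam_of t)"
    by (rule annotates_ityp[OF t])
      (use nm in \<open>auto simp: FDecl_sig_of ODecl_sig_of intro!: is_ctx_fam_of_list is_sig_sig_of\<close>)
  moreover have "coherent_sig ?S"
    by (auto simp: coherent_sig_def FDecl_sig_of ODecl_sig_of)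
  moreover have "coherent_ctx ?G"
    by (auto simp: coherent_ctx_def)
  ultimately show ?thesis
    unfolding annotates_def using fam_of_closed(3) by blast
qed

theorem theorem4:
  shows "(\<forall>S G K. is_kind S G K \<longrightarrow> strongly_normalizing red_k K) \<and>
         (\<forall>S G A K. has_kind S G A K \<longrightarrow> strongly_normalizing red_f A) \<and>
         (\<forall>S G D A. has_type S G D A \<longrightarrow> strongly_normalizing red_o D) \<and>
         (\<forall>M. strongly_normalizing beta M \<longrightarrow>
            (\<exists>S G D A. coherent_sig S \<and> coherent_ctx G \<and> coherent_o D \<and> coherent_f A \<and>
               has_type S G D A \<and> essence D = M))"
  unfolding strongly_normalizing_iff_sn using typing_sn sn_essence by blast

end
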